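(* Let $p\ge 1$ be an integer. Consider on $\mathbb{R}^{2p}$ the $\mathrm{U}(p)$-structure $(J_0,\omega_0,g_0)$, where $g_0$ is the standard inner product, $J_0(e_k)=e_{k+p}$ and $J_0(e_{k+p})=-e_k$ for $k=1,\dots,p$, and $\omega_0=e^1\wedge e^{1+p}+\cdots+e^p\wedge e^{2p}$. Then this $\mathrm{U}(p)$-structure induces a minimal left ideal of the Clifford algebra $\mathbb{R}_{p,p}$, and induces an embedded minimal left ideal of each of the Clifford algebras $\mathbb{R}_{p,p+1}$ and $\mathbb{R}_{p,p+2}$. The defining primitive idempotent is given in all three cases by $f_{\mathrm{U}(p)}=q^*(P^{\mathbb{Q}}(\omega_0))$. That is, for each $s\in\{p,p+1,p+2\}$ the element $f_{\mathrm{U}(p)}=q^*(P^{\mathbb{Q}}(\omega_0))\in\mathbb{R}_{p,s}$ is a primitive idempotent, so that $\mathbb{R}_{p,s}f_{\mathrm{U}(p)}$ is a minimal left ideal of $\mathbb{R}_{p,s}$.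
   Context: Clifford algebra: $\mathbb{R}_{p,q}$ is the real unital associative algebra generated by $e_1,\dots,e_{p+q}$ with $e_ie_j=-e_je_i$ for $i\ne j$, $e_i^2=1$ for $1\le i\le p$ and $e_i^2=-1$ for $p+1\le i\le p+q$. It has the canonical basis $1$ and $e_{i_1}\cdots e_{i_k}$, $i_1<\cdots<i_k$. Quantization map: $e_1,\dots,e_n$ is the standard basis of $\mathbb{R}^n$ and $e^1,\dots,e^n$ the dual basis. For $n=p+q$, $q^*:\bigwedge^\bullet(\mathbb{R}^{n})^*\to\mathbb{R}_{p,q}$ is the vector space isomorphism with $q^*(1)=1$ and $q^*(e^{i_1}\wedge\cdots\wedge e^{i_k})=e_{i_1}\cdots e_{i_k}$ for $i_1<\dots<i_k$. For $n<p+q$, the same formula defines an injective linear map (embedding) $q^*:\bigwedge^\bullet(\mathbb{R}^{n})^*\hookrightarrow\mathbb{R}_{p,q}$. Rational Kähler polynomial: for $\omega_0=\sum_{j=1}^n e^j\wedge e^{n+j}$ on $\mathbb{R}^{2n}$, $P^{\mathbb{Q}}(\omega_0)=\frac{1}{2^n}\sum_{m=0}^{n}\frac{\omega_0^m}{m!}$, where $\omega_0^m$ is the $m$-fold wedge power and $\omega_0^0=1$. Primitive idempotent: a nonzero $f$ with $f^2=f$ that is not a sum of two nonzero orthogonal idempotents. The minimal left ideals of $\mathbb{R}_{p,q}$ are of the form $\mathbb{R}_{p,q}f$ with $f$ a primitive idempotent. Inducing: a $\mathrm{G}$-structure defined by forms $\phi_1,\dots,\phi_k\in\bigwedge^\bullet(\mathbb{R}^n)^*$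 induces a minimal left ideal $\mathbb{R}_{p,q}f$ (case $n=p+q$), respectively induces an embedded minimal left ideal $\mathbb{R}_{p,q}f$ (case $n<p+q$), if $f$ is a primitive idempotent of $\mathbb{R}_{p,q}$ and $f=q^*(\psi(\phi_1,\dots,\phi_k))$ for some algebraic expression $\psi(\phi_1,\dots,\phi_k)$ in the exterior algebra $\bigwedge^\bullet(\mathbb{R}^n)^*$. A $\mathrm{U}(p)$-structure on $\mathbb{R}^{2p}$ is given by the triple $(J_0,\omega_0,g_0)$ with $\omega_0(\cdot,\cdot)=g_0(J_0\cdot,\cdot)$. *)

theory Defs
  imports Complex_Main "HOL-Algebra.Module" "HOL-Algebra.AbelCoset"
begin

section \<open>Clifford algebras of diagonal quadratic forms\<close>

text \<open>
  The real algebra with generators \<open>e_1, ..., e_n\<close>, relations \<open>e_i e_j = - e_j e_i\<close> for \<open>i \<noteq> j\<close>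
  and \<open>e_i e_i = Q i\<close>, on its canonical basis. An element is its coefficient function:
  \<open>x A\<close> is the coefficient of \<open>e_A = e_{i_1} ... e_{i_k}\<close>, where
  \<open>A = {i_1 < ... < i_k} \<subseteq> {1..n}\<close>. Sorting the concatenated word of \<open>e_A e_B\<close> takes one
  sign change for every pair \<open>(i, j) \<in> A \<times> B\<close> with \<open>j < i\<close>, and each repeated index \<open>i\<close>
  contributes the factor \<open>Q i\<close>, so \<open>e_A e_B = struct_const Q A B \<cdot> e_{A \<triangle> B}\<close>.
  The lemmas below confirm that this is a unital associative algebra satisfying the relations
  and that the ordered products of generators form a basis.
\<close>

type_synonym multivector = "nat set \<Rightarrow> real"

definition reorder_sign :: "nat set \<Rightarrow> nat set \<Rightarrow> real" where
  "reorder_sign A B = (-1) ^ card {(i, j). i \<in> A \<and> j \<in> B \<and> j < i}"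

definition struct_const :: "(nat \<Rightarrow> real) \<Rightarrow> nat set \<Rightarrow> nat set \<Rightarrow> real" where
  "struct_const Q A B = reorder_sign A B * (\<Prod>i\<in>A \<inter> B. Q i)"

definition diag_clifford :: "nat \<Rightarrow> (nat \<Rightarrow> real) \<Rightarrow> (real, multivector) module" where
  "diag_clifford n Q =
    \<lparr>carrier = {x. \<forall>A. \<not> A \<subseteq> {1..n} \<longrightarrow> x A = 0},
     mult = (\<lambda>x y C. \<Sum>A\<in>Pow {1..n}. \<Sum>B\<in>Pow {1..n}.
               if sym_diff A B = C then struct_const Q A B * x A * y B else 0),
     one = (\<lambda>A. if A = {} then 1 else 0),
     zero = (\<lambda>A. 0),
     add = (\<lambda>x y A. x A + y A),
     smult = (\<lambda>c x A. c * x A)\<rparr>"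

lemma reorder_sign_prod:
  assumes "finite A" "finite B"
  shows "reorder_sign A B = (\<Prod>i\<in>A. \<Prod>j\<in>B. if j < i then -1 else 1)"
proof -
  have "{(i, j). i \<in> A \<and> j \<in> B \<and> j < i} = {x \<in> A \<times> B. snd x < fst x}" by auto
  then have "reorder_sign A B = (\<Prod>x\<in>{x \<in> A \<times> B. snd x < fst x}. -1)"
    by (simp add: reorder_sign_def)
  also have "\<dots> = (\<Prod>x\<in>A \<times> B. if snd x < fst x then -1 else 1)"
    using assms by (intro prod.inter_filter) auto
  also have "\<dots> = (\<Prod>i\<in>A. \<Prod>j\<in>B. if j < i then -1 else 1)"
    by (simp add: prod.cartesian_product case_prod_unfold)
  finally show ?thesis .
qed

lemma prod_sym_diff:
  fixes f :: "nat \<Rightarrow> real"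
  assumes "finite A" "finite B"
  shows "(\<Prod>i\<in>A. f i) * (\<Prod>i\<in>B. f i) = (\<Prod>i\<in>sym_diff A B. f i) * (\<Prod>i\<in>A \<inter> B. f i * f i)"
proof -
  have "(\<Prod>i\<in>A. f i) = (\<Prod>i\<in>A - B. f i) * (\<Prod>i\<in>A \<inter> B. f i)"
    using assms by (metis Diff_Diff_Int Diff_subset prod.subset_diff mult.commute)
  moreover have "(\<Prod>i\<in>B. f i) = (\<Prod>i\<in>B - A. f i) * (\<Prod>i\<in>A \<inter> B. f i)"
    using assms by (metis Diff_Diff_Int Diff_subset prod.subset_diff mult.commute Int_commute)
  moreover have "(\<Prod>i\<in>sym_diff A B. f i) = (\<Prod>i\<in>A - B. f i) * (\<Prod>i\<in>B - A. f i)"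
    using assms by (intro prod.union_disjoint) auto
  ultimately show ?thesis by (simp add: prod.distrib)
qed

lemma reorder_sign_sym_diff:
  assumes "finite A" "finite B" "finite C"
  shows "reorder_sign (sym_diff A B) C = reorder_sign A C * reorder_sign B C"
    and "reorder_sign C (sym_diff A B) = reorder_sign C A * reorder_sign C B"
proof -
  have swap: "reorder_sign X Y = (\<Prod>j\<in>Y. \<Prod>i\<in>X. if j < i then -1 else 1)"
    if "finite X" "finite Y" for X Y
    unfolding reorder_sign_prod[OF that] by (rule prod.swap)
  have sq: "(\<Prod>x\<in>X. if P x then - 1 else 1) * (\<Prod>x\<in>X. if P x then - 1 else (1::real)) = 1"
    for X :: "nat set" and P
    unfolding prod.distrib[symmetric] by (rule prod.neutral) auto
  have fin: "finite (sym_diff A B)" using assms by simp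
  show "reorder_sign (sym_diff A B) C = reorder_sign A C * reorder_sign B C"
    unfolding reorder_sign_prod[OF fin assms(3)] reorder_sign_prod[OF assms(1,3)]
      reorder_sign_prod[OF assms(2,3)] prod_sym_diff[OF assms(1,2)] sq by simp
  show "reorder_sign C (sym_diff A B) = reorder_sign C A * reorder_sign C B"
    unfolding swap[OF assms(3) fin] swap[OF assms(3,1)]
      swap[OF assms(3,2)] prod_sym_diff[OF assms(1,2)] sq by simp
qed

lemma struct_const_cocycle:
  assumes "finite A" "finite B" "finite C"
  shows "struct_const Q A B * struct_const Q (sym_diff A B) C =
    struct_const Q B C * struct_const Q A (sym_diff B C)"
proof -
  have fin: "finite (A \<union> B \<union> C)" using assms by auto
  have r: "prod Q X = (\<Prod>i\<in>A \<union> B \<union> C. if i \<in> X then Q i else 1)" if "X \<subseteq> A \<union> B \<union> C" for X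
    using that fin by (simp add: prod.inter_restrict[symmetric] Int_absorb1)
  have sub: "A \<inter> B \<subseteq> A \<union> B \<union> C" "sym_diff A B \<inter> C \<subseteq> A \<union> B \<union> C"
    "B \<inter> C \<subseteq> A \<union> B \<union> C" "A \<inter> sym_diff B C \<subseteq> A \<union> B \<union> C" by auto
  have "prod Q (A \<inter> B) * prod Q (sym_diff A B \<inter> C) = prod Q (B \<inter> C) * prod Q (A \<inter> sym_diff B C)"
    unfolding r[OF sub(1)] r[OF sub(2)] r[OF sub(3)] r[OF sub(4)] prod.distrib[symmetric]
    by (intro prod.cong refl) auto
  moreover have "reorder_sign A B * reorder_sign (sym_diff A B) C =
      reorder_sign B C * reorder_sign A (sym_diff B C)"
    unfolding reorder_sign_sym_diff(1)[OF assms] reorder_sign_sym_diff(2)[OF assms(2,3,1)]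
    by simp
  moreover have "(s * u) * (t * v) = (s' * u') * (t' * v')"
    if "u * v = u' * v'" "s * t = s' * t'" for s t u v s' t' u' v' :: real
    using arg_cong2[OF that, of "(*)"] by (simp only: mult_ac)
  ultimately show ?thesis unfolding struct_const_def by blast
qed

lemma diag_clifford_simps:
  "carrier (diag_clifford n Q) = {x. \<forall>A. \<not> A \<subseteq> {1..n} \<longrightarrow> x A = 0}"
  "\<one>\<^bsub>diag_clifford n Q\<^esub> = (\<lambda>A. if A = {} then 1 else 0)"
  "\<zero>\<^bsub>diag_clifford n Q\<^esub> = (\<lambda>A. 0)"
  "x \<oplus>\<^bsub>diag_clifford n Q\<^esub> y = (\<lambda>A. x A + y A)"
  "c \<odot>\<^bsub>diag_clifford n Q\<^esub> x = (\<lambda>A. c * x A)"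
  by (simp_all add: diag_clifford_def)

lemma diag_clifford_mult:
  "(x \<otimes>\<^bsub>diag_clifford n Q\<^esub> y) C = (if C \<subseteq> {1..n} then
     \<Sum>A\<in>Pow {1..n}. struct_const Q A (sym_diff A C) * x A * y (sym_diff A C) else 0)"
proof -
  have "(\<Sum>B\<in>Pow {1..n}. if sym_diff A B = C then struct_const Q A B * x A * y B else 0) =
      (if C \<subseteq> {1..n} then struct_const Q A (sym_diff A C) * x A * y (sym_diff A C) else 0)"
    if A: "A \<subseteq> {1..n}" for A
  proof -
    have *: "sym_diff A B = C \<longleftrightarrow> B = sym_diff A C" for B by auto
    have "sym_diff A C \<subseteq> {1..n} \<longleftrightarrow> C \<subseteq> {1..n}" using A by auto
    then show ?thesis unfolding * by (simp add: sum.delta)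
  qed
  then show ?thesis by (simp add: diag_clifford_def)
qed

lemma diag_clifford_assoc:
  "(x \<otimes>\<^bsub>diag_clifford n Q\<^esub> y) \<otimes>\<^bsub>diag_clifford n Q\<^esub> z =
    x \<otimes>\<^bsub>diag_clifford n Q\<^esub> (y \<otimes>\<^bsub>diag_clifford n Q\<^esub> z)" (is "?L = ?R")
proof
  fix D
  let ?S = "{1..n}"
  let ?k = "struct_const Q"
  show "?L D = ?R D"
  proof (cases "D \<subseteq> ?S")
    case True
    have "?L D = (\<Sum>E\<in>Pow ?S. \<Sum>A\<in>Pow ?S. ?k E (sym_diff E D) *
        (?k A (sym_diff A E) * x A * y (sym_diff A E)) * z (sym_diff E D))"
      using True by (simp add: diag_clifford_mult sum_distrib_left sum_distrib_right)
    also have "\<dots> = (\<Sum>A\<in>Pow ?S. \<Sum>E\<in>Pow ?S. ?k E (sym_diff E D) *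
        (?k A (sym_diff A E) * x A * y (sym_diff A E)) * z (sym_diff E D))"
      by (rule sum.swap)
    also have "\<dots> = (\<Sum>A\<in>Pow ?S. \<Sum>F\<in>Pow ?S. ?k A (sym_diff A D) * x A *
        (?k F (sym_diff F (sym_diff A D)) * y F * z (sym_diff F (sym_diff A D))))"
    proof (rule sum.cong[OF refl])
      fix A assume "A \<in> Pow ?S"
      then have A: "A \<subseteq> ?S" by simp
      show "(\<Sum>E\<in>Pow ?S. ?k E (sym_diff E D) *
          (?k A (sym_diff A E) * x A * y (sym_diff A E)) * z (sym_diff E D)) =
        (\<Sum>F\<in>Pow ?S. ?k A (sym_diff A D) * x A *
          (?k F (sym_diff F (sym_diff A D)) * y F * z (sym_diff F (sym_diff A D))))"
      proof (rule sum.reindex_bij_witness[where i = "sym_diff A" and j = "sym_diff A"])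
        fix E assume "E \<in> Pow ?S"
        then have E: "E \<subseteq> ?S" by simp
        let ?F = "sym_diff A E"
        have e1: "sym_diff ?F (sym_diff A D) = sym_diff E D"
          and e2: "sym_diff A ?F = E" and e3: "sym_diff ?F (sym_diff E D) = sym_diff A D" by auto
        have "finite A" "finite E" "finite D"
          using A E True finite_subset by blast+
        then have c: "?k A ?F * ?k E (sym_diff E D) = ?k ?F (sym_diff E D) * ?k A (sym_diff A D)"
          using struct_const_cocycle[of A ?F "sym_diff E D" Q] unfolding e2 e3 by simp
        show "?k A (sym_diff A D) * x A *
            (?k ?F (sym_diff ?F (sym_diff A D)) * y ?F * z (sym_diff ?F (sym_diff A D))) =
          ?k E (sym_diff E D) * (?k A ?F * x A * y ?F) * z (sym_diff E D)"
          unfolding e1 using arg_cong[OF c, of "\<lambda>t. t * (x A * y ?F * z (sym_diff E D))"]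
          by (simp only: mult_ac)
      qed (use A in auto)
    qed
    also have "\<dots> = (\<Sum>A\<in>Pow ?S. ?k A (sym_diff A D) * x A *
        (y \<otimes>\<^bsub>diag_clifford n Q\<^esub> z) (sym_diff A D))"
    proof (rule sum.cong[OF refl])
      fix A assume "A \<in> Pow ?S"
      then have "sym_diff A D \<subseteq> ?S" using True by auto
      then show "(\<Sum>F\<in>Pow ?S. ?k A (sym_diff A D) * x A *
          (?k F (sym_diff F (sym_diff A D)) * y F * z (sym_diff F (sym_diff A D)))) =
        ?k A (sym_diff A D) * x A * (y \<otimes>\<^bsub>diag_clifford n Q\<^esub> z) (sym_diff A D)"
        by (simp only: diag_clifford_mult if_True sum_distrib_left)
    qed
    also have "\<dots> = ?R D" using True by (simp add: diag_clifford_mult[where x = x])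
    finally show ?thesis .
  qed (simp add: diag_clifford_mult)
qed

lemma struct_const_empty [simp]: "struct_const Q {} B = 1" "struct_const Q A {} = 1"
  by (simp_all add: struct_const_def reorder_sign_def)

lemma diag_clifford_mult_closed:
  "x \<otimes>\<^bsub>diag_clifford n Q\<^esub> y \<in> carrier (diag_clifford n Q)"
  unfolding diag_clifford_simps by (simp add: diag_clifford_mult)

lemma diag_clifford_one_mult:
  assumes "x \<in> carrier (diag_clifford n Q)"
  shows "\<one>\<^bsub>diag_clifford n Q\<^esub> \<otimes>\<^bsub>diag_clifford n Q\<^esub> x = x"
proof
  fix C
  have "struct_const Q A (sym_diff A C) * (if A = {} then 1 else 0) * x (sym_diff A C) =
      (if A = {} then x C else 0)" for A
    by simp
  then show "(\<one>\<^bsub>diag_clifford n Q\<^esub> \<otimes>\<^bsub>diag_clifford n Q\<^esub> x) C = x C"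
    using assms unfolding diag_clifford_mult diag_clifford_simps by (simp add: sum.delta)
qed

lemma diag_clifford_mult_one:
  assumes "x \<in> carrier (diag_clifford n Q)"
  shows "x \<otimes>\<^bsub>diag_clifford n Q\<^esub> \<one>\<^bsub>diag_clifford n Q\<^esub> = x"
proof
  fix C
  have "struct_const Q A (sym_diff A C) * x A * (if sym_diff A C = {} then 1 else 0) =
      (if A = C then x C else 0)" for A
  proof (cases "A = C")
    case False
    then have "sym_diff A C \<noteq> {}" by auto
    then show ?thesis using False by (simp only: if_False mult_zero_right)
  qed simp
  then have "(\<Sum>A\<in>Pow {1..n}. struct_const Q A (sym_diff A C) * x A *
      (if sym_diff A C = {} then 1 else 0)) = (\<Sum>A\<in>Pow {1..n}. if A = C then x C else 0)"
    by (rule sum.cong[OF refl])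
  then show "(x \<otimes>\<^bsub>diag_clifford n Q\<^esub> \<one>\<^bsub>diag_clifford n Q\<^esub>) C = x C"
    using assms unfolding diag_clifford_mult diag_clifford_simps by (simp add: sum.delta)
qed

lemma diag_clifford_distrib:
  "(x \<oplus>\<^bsub>diag_clifford n Q\<^esub> y) \<otimes>\<^bsub>diag_clifford n Q\<^esub> z =
    x \<otimes>\<^bsub>diag_clifford n Q\<^esub> z \<oplus>\<^bsub>diag_clifford n Q\<^esub> y \<otimes>\<^bsub>diag_clifford n Q\<^esub> z"
  "z \<otimes>\<^bsub>diag_clifford n Q\<^esub> (x \<oplus>\<^bsub>diag_clifford n Q\<^esub> y) =
    z \<otimes>\<^bsub>diag_clifford n Q\<^esub> x \<oplus>\<^bsub>diag_clifford n Q\<^esub> z \<otimes>\<^bsub>diag_clifford n Q\<^esub> y"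
  unfolding diag_clifford_simps diag_clifford_mult fun_eq_iff
  by (simp_all only: distrib_left distrib_right sum.distrib split: if_split) simp_all

lemma ring_diag_clifford: "ring (diag_clifford n Q)"
proof (rule ringI)
  let ?R = "diag_clifford n Q"
  show "abelian_group ?R"
  proof (rule abelian_groupI)
    fix x assume "x \<in> carrier ?R"
    then show "\<exists>y\<in>carrier ?R. y \<oplus>\<^bsub>?R\<^esub> x = \<zero>\<^bsub>?R\<^esub>"
      by (intro bexI[of _ "\<lambda>A. - x A"]) (simp_all add: diag_clifford_simps)
  qed (simp_all add: diag_clifford_simps fun_eq_iff)
  show "monoid ?R"
  proof (rule monoidI)
    show "\<one>\<^bsub>?R\<^esub> \<in> carrier ?R" by (simp add: diag_clifford_simps)
  qed (rule diag_clifford_mult_closed diag_clifford_assoc diag_clifford_one_mult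
      diag_clifford_mult_one; assumption?)+
qed (rule diag_clifford_distrib)+

lemma diag_clifford_smult_mult:
  "(c \<odot>\<^bsub>diag_clifford n Q\<^esub> x) \<otimes>\<^bsub>diag_clifford n Q\<^esub> y =
    c \<odot>\<^bsub>diag_clifford n Q\<^esub> (x \<otimes>\<^bsub>diag_clifford n Q\<^esub> y)"
  "x \<otimes>\<^bsub>diag_clifford n Q\<^esub> (c \<odot>\<^bsub>diag_clifford n Q\<^esub> y) =
    c \<odot>\<^bsub>diag_clifford n Q\<^esub> (x \<otimes>\<^bsub>diag_clifford n Q\<^esub> y)"
  unfolding diag_clifford_simps diag_clifford_mult fun_eq_iff
  by (simp_all add: sum_distrib_left mult_ac)

definition clifford :: "nat \<Rightarrow> nat \<Rightarrow> (real, multivector) module" where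
  "clifford p q = diag_clifford (p + q) (\<lambda>i. if i \<le> p then 1 else -1)"

text \<open>
  The exterior algebra of \<open>(\<real>\<^sup>n)\<^sup>*\<close> is the case \<open>Q = 0\<close>; its generators are the
  dual basis covectors \<open>e^1, ..., e^n\<close> and its product is the wedge product.
\<close>

definition exterior :: "nat \<Rightarrow> (real, multivector) module" where
  "exterior n = diag_clifford n (\<lambda>i. 0)"

definition generator :: "nat \<Rightarrow> multivector" where
  "generator i = (\<lambda>A. if A = {i} then 1 else 0)"

definition ordered_product :: "(real, multivector) module \<Rightarrow> nat set \<Rightarrow> multivector" where
  "ordered_product R I = foldr (\<lambda>i x. generator i \<otimes>\<^bsub>R\<^esub> x) (sorted_list_of_set I) \<one>\<^bsub>R\<^esub>"

lemma basis_mult: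
  assumes "A \<subseteq> {1..n}" "B \<subseteq> {1..n}"
  shows "(\<lambda>C. if C = A then 1 else 0) \<otimes>\<^bsub>diag_clifford n Q\<^esub> (\<lambda>C. if C = B then 1 else 0) =
    (\<lambda>C. if C = sym_diff A B then struct_const Q A B else 0)"
proof
  fix C
  have *: "sym_diff A C = B \<longleftrightarrow> C = sym_diff A B" for C by auto
  have sub: "sym_diff A B \<subseteq> {1..n}" using assms by auto
  have "struct_const Q A' (sym_diff A' C) * (if A' = A then 1 else 0) *
      (if sym_diff A' C = B then 1 else 0) =
    (if A' = A then if C = sym_diff A B then struct_const Q A B else 0 else 0)" for A'
  proof (cases "A' = A \<and> C = sym_diff A B")
    case True
    then have "sym_diff A' C = B" by auto
    then show ?thesis using True by simp
  qed (use * in auto)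
  then have "(\<Sum>A'\<in>Pow {1..n}. struct_const Q A' (sym_diff A' C) * (if A' = A then 1 else 0) *
      (if sym_diff A' C = B then 1 else 0)) =
    (\<Sum>A'\<in>Pow {1..n}. if A' = A then if C = sym_diff A B then struct_const Q A B else 0 else 0)"
    by (simp only:)
  also have "\<dots> = (if C = sym_diff A B then struct_const Q A B else 0)"
    using assms by (simp add: sum.delta)
  finally show "((\<lambda>C. if C = A then 1 else 0) \<otimes>\<^bsub>diag_clifford n Q\<^esub>
      (\<lambda>C. if C = B then 1 else 0)) C = (if C = sym_diff A B then struct_const Q A B else 0)"
    unfolding diag_clifford_mult using sub by auto
qed

lemma generator_relations:
  assumes "i \<in> {1..n}" "j \<in> {1..n}"
  shows "generator i \<otimes>\<^bsub>diag_clifford n Q\<^esub> generator i = Q i \<odot>\<^bsub>diag_clifford n Q\<^esub> \<one>\<^bsub>diag_clifford n Q\<^esub>"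
    and "i \<noteq> j \<Longrightarrow> generator i \<otimes>\<^bsub>diag_clifford n Q\<^esub> generator j =
      (-1) \<odot>\<^bsub>diag_clifford n Q\<^esub> (generator j \<otimes>\<^bsub>diag_clifford n Q\<^esub> generator i)"
proof -
  let ?R = "diag_clifford n Q"
  have i: "{i} \<subseteq> {1..n}" and j: "{j} \<subseteq> {1..n}" using assms by auto
  have s: "{(a, b). a \<in> {k} \<and> b \<in> {l} \<and> b < a} = (if l < k then {(k, l)} else {})"
    for k l :: nat by auto
  show "generator i \<otimes>\<^bsub>?R\<^esub> generator i = Q i \<odot>\<^bsub>?R\<^esub> \<one>\<^bsub>?R\<^esub>"
    unfolding generator_def basis_mult[OF i i]
    unfolding struct_const_def reorder_sign_def s by (simp add: diag_clifford_simps fun_eq_iff)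
  assume ne: "i \<noteq> j"
  then have c: "sym_diff {i} {j} = sym_diff {j} {i}" by auto
  have "struct_const Q {i} {j} = - struct_const Q {j} {i}"
    using ne unfolding struct_const_def reorder_sign_def s by auto
  then show "generator i \<otimes>\<^bsub>?R\<^esub> generator j = (-1) \<odot>\<^bsub>?R\<^esub> (generator j \<otimes>\<^bsub>?R\<^esub> generator i)"
    unfolding generator_def basis_mult[OF i j] basis_mult[OF j i] c
    by (simp add: diag_clifford_simps fun_eq_iff)
qed

lemma ordered_product_eq:
  assumes "I \<subseteq> {1..n}"
  shows "ordered_product (diag_clifford n Q) I = (\<lambda>A. if A = I then 1 else 0)"
proof -
  have "foldr (\<lambda>i x. generator i \<otimes>\<^bsub>diag_clifford n Q\<^esub> x) xs \<one>\<^bsub>diag_clifford n Q\<^esub> =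
      (\<lambda>A. if A = set xs then 1 else 0)"
    if "sorted_wrt (<) xs" "set xs \<subseteq> {1..n}" for xs
    using that
  proof (induction xs)
    case (Cons i xs)
    have "struct_const Q {i} (set xs) = 1"
    proof -
      have "{(a, b). a \<in> {i} \<and> b \<in> set xs \<and> b < a} = {}" "{i} \<inter> set xs = {}"
        using Cons.prems by auto
      then show ?thesis unfolding struct_const_def reorder_sign_def by (simp only:) simp
    qed
    moreover have "sym_diff {i} (set xs) = set (i # xs)" using Cons.prems by auto
    moreover have "generator i \<otimes>\<^bsub>diag_clifford n Q\<^esub> (\<lambda>A. if A = set xs then 1 else 0) =
        (\<lambda>C. if C = sym_diff {i} (set xs) then struct_const Q {i} (set xs) else 0)"
      unfolding generator_def by (rule basis_mult) (use Cons.prems in auto)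
    ultimately show ?case using Cons by (simp only: foldr_Cons o_apply) simp
  qed (simp add: diag_clifford_simps)
  then show ?thesis
    using assms finite_subset[OF assms] unfolding ordered_product_def by simp
qed

lemma diag_clifford_finsum:
  assumes "finite I" "\<And>i. i \<in> I \<Longrightarrow> h i \<in> carrier (diag_clifford n Q)"
  shows "(\<Oplus>\<^bsub>diag_clifford n Q\<^esub>i\<in>I. h i) = (\<lambda>A. \<Sum>i\<in>I. h i A)"
proof -
  interpret ring "diag_clifford n Q" by (rule ring_diag_clifford)
  show ?thesis using assms
    by (induction I rule: finite_induct) (simp_all add: diag_clifford_simps Pi_def)
qed

lemma ordered_products_basis:
  assumes "\<And>A. \<not> A \<subseteq> {1..n} \<Longrightarrow> c A = 0"
  shows "(\<Oplus>\<^bsub>diag_clifford n Q\<^esub>I\<in>Pow {1..n}.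
    c I \<odot>\<^bsub>diag_clifford n Q\<^esub> ordered_product (diag_clifford n Q) I) = c"
proof -
  have "(\<Oplus>\<^bsub>diag_clifford n Q\<^esub>I\<in>Pow {1..n}.
      c I \<odot>\<^bsub>diag_clifford n Q\<^esub> ordered_product (diag_clifford n Q) I) =
    (\<lambda>A. \<Sum>I\<in>Pow {1..n}. (c I \<odot>\<^bsub>diag_clifford n Q\<^esub> ordered_product (diag_clifford n Q) I) A)"
    by (rule diag_clifford_finsum) (auto simp: diag_clifford_simps ordered_product_eq)
  also have "\<dots> = (\<lambda>A. \<Sum>I\<in>Pow {1..n}. if I = A then c A else 0)"
    by (rule ext, rule sum.cong) (auto simp: diag_clifford_simps ordered_product_eq)
  also have "\<dots> = c" using assms by (auto simp: sum.delta)
  finally show ?thesis .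
qed

text \<open>The linear map \<open>q\<^sup>*\<close> from the exterior algebra of \<open>(\<real>\<^sup>n)\<^sup>*\<close> to the Clifford
  algebra of signature \<open>(p, q)\<close>; it is meant for \<open>n \<le> p + q\<close>.\<close>

definition quantization :: "nat \<Rightarrow> nat \<Rightarrow> nat \<Rightarrow> multivector \<Rightarrow> multivector" where
  "quantization n p q \<alpha> =
    (\<Oplus>\<^bsub>clifford p q\<^esub>I\<in>Pow {1..n}. \<alpha> I \<odot>\<^bsub>clifford p q\<^esub> ordered_product (clifford p q) I)"

lemma quantization_coeffs:
  assumes "n \<le> p + q" "\<alpha> \<in> carrier (exterior n)"
  shows "quantization n p q \<alpha> = \<alpha>"
proof -
  let ?Q = "\<lambda>i. if i \<le> p then 1 else (-1::real)"
  have sub: "I \<subseteq> {1..p + q}" if "I \<in> Pow {1..n}" for I using that assms(1) by auto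
  have "quantization n p q \<alpha> = (\<lambda>A. \<Sum>I\<in>Pow {1..n}.
      (\<alpha> I \<odot>\<^bsub>diag_clifford (p + q) ?Q\<^esub> ordered_product (diag_clifford (p + q) ?Q) I) A)"
    unfolding quantization_def clifford_def using sub
    by (intro diag_clifford_finsum) (auto simp: diag_clifford_simps ordered_product_eq)
  also have "\<dots> = (\<lambda>A. \<Sum>I\<in>Pow {1..n}. if I = A then \<alpha> A else 0)"
    using sub by (intro ext sum.cong refl) (simp add: diag_clifford_simps ordered_product_eq)
  also have "\<dots> = \<alpha>"
    using assms(2) by (auto simp: sum.delta exterior_def diag_clifford_simps)
  finally show ?thesis .
qed

lemma quantization_ordered_product:
  assumes "n \<le> p + q" "I \<subseteq> {1..n}"
  shows "quantization n p q (ordered_product (exterior n) I) = ordered_product (clifford p q) I"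
proof -
  have "ordered_product (exterior n) I = (\<lambda>A. if A = I then 1 else 0)"
    unfolding exterior_def by (rule ordered_product_eq[OF assms(2)])
  moreover have "ordered_product (clifford p q) I = (\<lambda>A. if A = I then 1 else 0)"
    unfolding clifford_def by (rule ordered_product_eq) (use assms in auto)
  moreover have "(\<lambda>A. if A = I then 1 else 0) \<in> carrier (exterior n)"
    using assms(2) by (simp add: exterior_def diag_clifford_simps)
  ultimately show ?thesis using quantization_coeffs[OF assms(1)] by simp
qed


section \<open>Idempotents and left ideals\<close>

definition idempotent_elem :: "('a, 'b) ring_scheme \<Rightarrow> 'a \<Rightarrow> bool" where
  "idempotent_elem R f \<longleftrightarrow> f \<in> carrier R \<and> f \<otimes>\<^bsub>R\<^esub> f = f"

definition primitive_idempotent :: "('a, 'b) ring_scheme \<Rightarrow> 'a \<Rightarrow> bool" where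
  "primitive_idempotent R f \<longleftrightarrow> idempotent_elem R f \<and> f \<noteq> \<zero>\<^bsub>R\<^esub> \<and>
    \<not> (\<exists>g h. idempotent_elem R g \<and> idempotent_elem R h \<and> g \<noteq> \<zero>\<^bsub>R\<^esub> \<and> h \<noteq> \<zero>\<^bsub>R\<^esub> \<and>
           g \<otimes>\<^bsub>R\<^esub> h = \<zero>\<^bsub>R\<^esub> \<and> h \<otimes>\<^bsub>R\<^esub> g = \<zero>\<^bsub>R\<^esub> \<and> f = g \<oplus>\<^bsub>R\<^esub> h)"

definition left_ideal :: "'a set \<Rightarrow> ('a, 'b) ring_scheme \<Rightarrow> bool" where
  "left_ideal I R \<longleftrightarrow> additive_subgroup I R \<and> (\<forall>a\<in>carrier R. \<forall>x\<in>I. a \<otimes>\<^bsub>R\<^esub> x \<in> I)"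

definition minimal_left_ideal :: "'a set \<Rightarrow> ('a, 'b) ring_scheme \<Rightarrow> bool" where
  "minimal_left_ideal I R \<longleftrightarrow> left_ideal I R \<and> I \<noteq> {\<zero>\<^bsub>R\<^esub>} \<and>
    (\<forall>K. left_ideal K R \<and> K \<subseteq> I \<longrightarrow> K = {\<zero>\<^bsub>R\<^esub>} \<or> K = I)"

definition principal_left_ideal :: "('a, 'b) ring_scheme \<Rightarrow> 'a \<Rightarrow> 'a set" where
  "principal_left_ideal R f = (\<lambda>a. a \<otimes>\<^bsub>R\<^esub> f) ` carrier R"


section \<open>Ideals induced by structures defined by forms\<close>

text \<open>The values of the algebraic expressions in the forms \<open>\<Phi>\<close>, built with real constants,
  sums and wedge products.\<close>

inductive_set algebraic_expressions :: "nat \<Rightarrow> multivector set \<Rightarrow> multivector set"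
  for n :: nat and \<Phi> :: "multivector set" where
  form: "\<phi> \<in> \<Phi> \<Longrightarrow> \<phi> \<in> algebraic_expressions n \<Phi>"
| const: "c \<odot>\<^bsub>exterior n\<^esub> \<one>\<^bsub>exterior n\<^esub> \<in> algebraic_expressions n \<Phi>"
| plus: "\<lbrakk>\<alpha> \<in> algebraic_expressions n \<Phi>; \<beta> \<in> algebraic_expressions n \<Phi>\<rbrakk>
    \<Longrightarrow> \<alpha> \<oplus>\<^bsub>exterior n\<^esub> \<beta> \<in> algebraic_expressions n \<Phi>"
| wedge: "\<lbrakk>\<alpha> \<in> algebraic_expressions n \<Phi>; \<beta> \<in> algebraic_expressions n \<Phi>\<rbrakk>
    \<Longrightarrow> \<alpha> \<otimes>\<^bsub>exterior n\<^esub> \<beta> \<in> algebraic_expressions n \<Phi>"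

text \<open>\<open>\<Phi>\<close> is the set of forms on \<open>\<real>\<^sup>n\<close> defining the structure, \<open>f\<close> the defining idempotent of
  the induced ideal.\<close>

definition induces_minimal_left_ideal ::
    "nat \<Rightarrow> multivector set \<Rightarrow> nat \<Rightarrow> nat \<Rightarrow> multivector \<Rightarrow> bool" where
  "induces_minimal_left_ideal n \<Phi> p q f \<longleftrightarrow>
    n = p + q \<and> \<Phi> \<subseteq> carrier (exterior n) \<and> primitive_idempotent (clifford p q) f \<and>
    (\<exists>\<psi>\<in>algebraic_expressions n \<Phi>. f = quantization n p q \<psi>)"

definition induces_embedded_minimal_left_ideal ::
    "nat \<Rightarrow> multivector set \<Rightarrow> nat \<Rightarrow> nat \<Rightarrow> multivector \<Rightarrow> bool" where
  "induces_embedded_minimal_left_ideal n \<Phi> p q f \<longleftrightarrow>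
    n < p + q \<and> \<Phi> \<subseteq> carrier (exterior n) \<and> primitive_idempotent (clifford p q) f \<and>
    (\<exists>\<psi>\<in>algebraic_expressions n \<Phi>. f = quantization n p q \<psi>)"

definition kahler_poly :: "nat \<Rightarrow> multivector \<Rightarrow> multivector" where
  "kahler_poly n \<omega> = (1 / 2 ^ n) \<odot>\<^bsub>exterior (2 * n)\<^esub>
     (\<Oplus>\<^bsub>exterior (2 * n)\<^esub>m\<in>{0..n}. (1 / fact m) \<odot>\<^bsub>exterior (2 * n)\<^esub> (\<omega> [^]\<^bsub>exterior (2 * n)\<^esub> m))"


section \<open>The standard unitary structure\<close>

definition coord_space :: "nat \<Rightarrow> (nat \<Rightarrow> real) set" where
  "coord_space n = {x. \<forall>i. i \<notin> {1..n} \<longrightarrow> x i = 0}"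

definition basis_vector :: "nat \<Rightarrow> nat \<Rightarrow> real" where
  "basis_vector k = (\<lambda>i. if i = k then 1 else 0)"

text \<open>A 2-form as a bilinear map, with
  \<open>(e^i \<and> e^j)(x, y) = x i * y j - x j * y i\<close>.\<close>

definition two_forms :: "nat \<Rightarrow> multivector set" where
  "two_forms n = {\<alpha> \<in> carrier (exterior n). \<forall>A. \<alpha> A \<noteq> 0 \<longrightarrow> card A = 2}"

definition eval_two_form :: "nat \<Rightarrow> multivector \<Rightarrow> (nat \<Rightarrow> real) \<Rightarrow> (nat \<Rightarrow> real) \<Rightarrow> real" where
  "eval_two_form n \<alpha> x y = (\<Sum>j\<in>{1..n}. \<Sum>i\<in>{1..<j}. \<alpha> {i, j} * (x i * y j - x j * y i))"

definition linear_endo :: "nat \<Rightarrow> ((nat \<Rightarrow> real) \<Rightarrow> (nat \<Rightarrow> real)) \<Rightarrow> bool" where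
  "linear_endo n J \<longleftrightarrow> J ` coord_space n \<subseteq> coord_space n \<and>
    (\<forall>x\<in>coord_space n. \<forall>y\<in>coord_space n. \<forall>a b.
       J (\<lambda>i. a * x i + b * y i) = (\<lambda>i. a * J x i + b * J y i))"

definition inner_product :: "nat \<Rightarrow> ((nat \<Rightarrow> real) \<Rightarrow> (nat \<Rightarrow> real) \<Rightarrow> real) \<Rightarrow> bool" where
  "inner_product n g \<longleftrightarrow>
    (\<forall>x\<in>coord_space n. \<forall>y\<in>coord_space n. g x y = g y x) \<and>
    (\<forall>x\<in>coord_space n. \<forall>y\<in>coord_space n. \<forall>z\<in>coord_space n. \<forall>a b.
       g (\<lambda>i. a * x i + b * y i) z = a * g x z + b * g y z) \<and>
    (\<forall>x\<in>coord_space n. x \<noteq> (\<lambda>i. 0) \<longrightarrow> g x x > 0)"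

definition unitary_structure ::
    "nat \<Rightarrow> ((nat \<Rightarrow> real) \<Rightarrow> (nat \<Rightarrow> real)) \<Rightarrow> multivector \<Rightarrow>
     ((nat \<Rightarrow> real) \<Rightarrow> (nat \<Rightarrow> real) \<Rightarrow> real) \<Rightarrow> bool" where
  "unitary_structure p J \<omega> g \<longleftrightarrow>
    linear_endo (2 * p) J \<and> (\<forall>x\<in>coord_space (2 * p). J (J x) = (\<lambda>i. - x i)) \<and>
    inner_product (2 * p) g \<and>
    (\<forall>x\<in>coord_space (2 * p). \<forall>y\<in>coord_space (2 * p). g (J x) (J y) = g x y) \<and>
    \<omega> \<in> two_forms (2 * p) \<and>
    (\<forall>x\<in>coord_space (2 * p). \<forall>y\<in>coord_space (2 * p). eval_two_form (2 * p) \<omega> x y = g (J x) y)"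

definition g0 :: "nat \<Rightarrow> (nat \<Rightarrow> real) \<Rightarrow> (nat \<Rightarrow> real) \<Rightarrow> real" where
  "g0 p x y = (\<Sum>i\<in>{1..2 * p}. x i * y i)"

text \<open>The linear map with \<open>J e_k = e_{k+p}\<close> and \<open>J e_{k+p} = - e_k\<close> for \<open>k = 1, ..., p\<close>.\<close>

definition J0 :: "nat \<Rightarrow> (nat \<Rightarrow> real) \<Rightarrow> (nat \<Rightarrow> real)" where
  "J0 p x = (\<lambda>i. \<Sum>k\<in>{1..p}. x k * basis_vector (k + p) i - x (k + p) * basis_vector k i)"

definition omega0 :: "nat \<Rightarrow> multivector" where
  "omega0 p =
    (\<Oplus>\<^bsub>exterior (2 * p)\<^esub>k\<in>{1..p}. generator k \<otimes>\<^bsub>exterior (2 * p)\<^esub> generator (k + p))"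

definition f_U :: "nat \<Rightarrow> nat \<Rightarrow> multivector" where
  "f_U p s = quantization (2 * p) p s (kahler_poly p (omega0 p))"

end

theory Submission
  imports Defs
begin

text \<open>
  Write \<open>u k = e_k e_{k+p}\<close>. In the exterior algebra the \<open>u k\<close> commute and square to zero, so
  \<open>exp \<omega>0 = (1 + u 1) \<cdots> (1 + u p)\<close>; the factors involve disjoint sets of generators, so the
  product is the same in the Clifford algebra. There \<open>u k\<close> squares to \<open>1\<close>, and \<open>f\<close> is the product of
  the commuting idempotents \<open>(1 + u k) / 2\<close>. The corner \<open>f R f\<close> equals \<open>D f\<close>, where \<open>D\<close> is generated
  by the at most two remaining generators, all of square \<open>-1\<close>: it is a division algebra
  (the reals, the complex numbers or the quaternions), which makes \<open>f\<close> primitive. A nonzero left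
  ideal \<open>K\<close> inside \<open>R f\<close> contains \<open>f\<close>: the trace form \<open>(x, y) \<mapsto> (x y) {}\<close> is symmetric and
  nondegenerate, so \<open>f R x \<noteq> 0\<close> for nonzero \<open>x \<in> K\<close>, and \<open>f R x\<close> lies in the corner.
\<close>

section \<open>Idempotents with a division corner\<close>

text \<open>A summand \<open>g\<close> of an orthogonal decomposition satisfies
  \<open>g = f g f\<close>, so it lies in the corner. A left inverse \<open>z\<close> with
  \<open>z g = f\<close> then forces \<open>h = f h = z g h = 0\<close>.\<close>

lemma (in ring) primitive_idempotent_if_corner_division:
  assumes f: "idempotent_elem R f" "f \<noteq> \<zero>"
    and inv: "\<And>y. y \<in> carrier R \<Longrightarrow> f \<otimes> y \<otimes> f \<noteq> \<zero> \<Longrightarrow> \<exists>z\<in>carrier R. z \<otimes> (f \<otimes> y \<otimes> f) = f"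
  shows "primitive_idempotent R f"
  unfolding primitive_idempotent_def
proof (intro conjI notI f, elim exE conjE)
  fix g h
  assume g: "idempotent_elem R g" "g \<noteq> \<zero>" and h: "idempotent_elem R h" "h \<noteq> \<zero>"
    and gh: "g \<otimes> h = \<zero>" "h \<otimes> g = \<zero>" and sum: "f = g \<oplus> h"
  have car: "g \<in> carrier R" "h \<in> carrier R" "f \<in> carrier R"
    and idem: "g \<otimes> g = g" "h \<otimes> h = h"
    using f g h unfolding idempotent_elem_def by auto
  have "f \<otimes> g = g" "g \<otimes> f = g" and fh: "f \<otimes> h = h"
    using car idem gh by (simp_all add: sum l_distr r_distr)
  then have "f \<otimes> g \<otimes> f = g" by simp
  then obtain z where z: "z \<in> carrier R" "z \<otimes> g = f" using inv[OF car(1)] g by auto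
  have "h = z \<otimes> g \<otimes> h" using z fh by simp
  also have "\<dots> = \<zero>" using z(1) car gh by (simp add: m_assoc)
  finally show False using h by simp
qed

lemma (in ring) left_ideal_principal:
  assumes "f \<in> carrier R"
  shows "left_ideal (principal_left_ideal R f) R"
  unfolding left_ideal_def
proof (intro conjI ballI)
  show "additive_subgroup (principal_left_ideal R f) R"
  proof (intro additive_subgroup.intro add.subgroupI)
    show "principal_left_ideal R f \<noteq> {}" unfolding principal_left_ideal_def by auto
  next
    fix a assume "a \<in> principal_left_ideal R f"
    then obtain c where "c \<in> carrier R" "a = c \<otimes> f" unfolding principal_left_ideal_def by auto
    then have "\<ominus> a = (\<ominus> c) \<otimes> f" "\<ominus> c \<in> carrier R" using assms by (simp_all add: l_minus)
    then show "\<ominus> a \<in> principal_left_ideal R f" unfolding principal_left_ideal_def by blast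
  next
    fix a b assume "a \<in> principal_left_ideal R f" "b \<in> principal_left_ideal R f"
    then obtain c d where "c \<in> carrier R" "a = c \<otimes> f" "d \<in> carrier R" "b = d \<otimes> f"
      unfolding principal_left_ideal_def by auto
    then have "a \<oplus> b = (c \<oplus> d) \<otimes> f" "c \<oplus> d \<in> carrier R" using assms by (simp_all add: l_distr)
    then show "a \<oplus> b \<in> principal_left_ideal R f" unfolding principal_left_ideal_def by blast
  qed (use assms in \<open>auto simp: principal_left_ideal_def\<close>)
next
  fix a x assume a: "a \<in> carrier R" and "x \<in> principal_left_ideal R f"
  then obtain c where "c \<in> carrier R" "x = c \<otimes> f" unfolding principal_left_ideal_def by auto
  then have "a \<otimes> x = (a \<otimes> c) \<otimes> f" "a \<otimes> c \<in> carrier R" using a assms by (simp_all add: m_assoc)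
  then show "a \<otimes> x \<in> principal_left_ideal R f" unfolding principal_left_ideal_def by blast
qed

text \<open>Since \<open>x f = x\<close> on \<open>R f\<close>, every \<open>f a x\<close> lies in
  the corner, where a left inverse brings it back to \<open>f\<close>. The condition
  \<open>nondeg\<close> supplies a nonzero such element. It fails for \<open>f = E_22\<close> in the
  upper triangular 2x2 matrices over a field: there the corner is a field, yet \<open>R f\<close>
  contains the smaller left ideal spanned by \<open>E_12\<close>.\<close>

lemma (in ring) minimal_left_ideal_if_corner_division:
  assumes f: "idempotent_elem R f" "f \<noteq> \<zero>"
    and inv: "\<And>y. y \<in> carrier R \<Longrightarrow> f \<otimes> y \<otimes> f \<noteq> \<zero> \<Longrightarrow> \<exists>z\<in>carrier R. z \<otimes> (f \<otimes> y \<otimes> f) = f"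
    and nondeg: "\<And>x. x \<in> carrier R \<Longrightarrow> x \<otimes> f = x \<Longrightarrow> x \<noteq> \<zero> \<Longrightarrow> \<exists>a\<in>carrier R. f \<otimes> a \<otimes> x \<noteq> \<zero>"
  shows "minimal_left_ideal (principal_left_ideal R f) R"
  unfolding minimal_left_ideal_def
proof (intro conjI allI impI)
  have fc: "f \<in> carrier R" and ff: "f \<otimes> f = f" using f unfolding idempotent_elem_def by auto
  show "left_ideal (principal_left_ideal R f) R" by (rule left_ideal_principal[OF fc])
  have "f \<in> principal_left_ideal R f"
    unfolding principal_left_ideal_def using fc ff by force
  then show "principal_left_ideal R f \<noteq> {\<zero>}" using f by auto
  fix K assume "left_ideal K R \<and> K \<subseteq> principal_left_ideal R f"
  then have K: "additive_subgroup K R" and mul: "\<And>a x. a \<in> carrier R \<Longrightarrow> x \<in> K \<Longrightarrow> a \<otimes> x \<in> K"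
    and sub: "K \<subseteq> principal_left_ideal R f"
    unfolding left_ideal_def by auto
  show "K = {\<zero>} \<or> K = principal_left_ideal R f"
  proof (cases "K = {\<zero>}")
    case False
    then obtain x where x: "x \<in> K" "x \<noteq> \<zero>"
      using additive_subgroup.zero_closed[OF K] by auto
    have xf: "x \<otimes> f = x" "x \<in> carrier R"
      using x sub fc ff unfolding principal_left_ideal_def by (auto simp: m_assoc)
    obtain a where a: "a \<in> carrier R" "f \<otimes> a \<otimes> x \<noteq> \<zero>" using nondeg xf x by auto
    have eq: "f \<otimes> (a \<otimes> x) \<otimes> f = f \<otimes> a \<otimes> x" using a xf fc by (simp add: m_assoc)
    obtain z where z: "z \<in> carrier R" "z \<otimes> (f \<otimes> (a \<otimes> x) \<otimes> f) = f"
      using inv[of "a \<otimes> x"] a xf eq by auto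
    have "f \<in> K" using mul[of "z \<otimes> (f \<otimes> a)" x] z a x xf fc eq by (simp add: m_assoc)
    then have "principal_left_ideal R f \<subseteq> K" unfolding principal_left_ideal_def using mul by auto
    then show ?thesis using sub by auto
  qed simp
qed

section \<open>The standard unitary structure\<close>

text \<open>The canonical basis element \<open>e_A\<close>. For \<open>A\<close> inside
  \<open>{1..n}\<close> it is the ordered product of generators by
  \<open>ordered_product_eq\<close>, but the coefficient form is literally the same in all the
  algebras and allows comparison across them.\<close>

definition blade :: "nat set \<Rightarrow> multivector" where
  "blade A = (\<lambda>C. if C = A then 1 else 0)"

lemma blade_closed: "A \<subseteq> {1..n} \<Longrightarrow> blade A \<in> carrier (diag_clifford n Q)"
  by (auto simp: blade_def diag_clifford_simps)

lemma blade_empty: "blade {} = \<one>\<^bsub>diag_clifford n Q\<^esub>"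
  by (simp add: blade_def diag_clifford_simps)

lemma blade_mult:
  assumes "A \<subseteq> {1..n}" "B \<subseteq> {1..n}"
  shows "blade A \<otimes>\<^bsub>diag_clifford n Q\<^esub> blade B =
    struct_const Q A B \<odot>\<^bsub>diag_clifford n Q\<^esub> blade (sym_diff A B)"
  unfolding blade_def basis_mult[OF assms] by (simp add: diag_clifford_simps fun_eq_iff)

lemma generator_mult_blade:
  assumes "1 \<le> i" "i < j" "j \<le> n"
  shows "generator i \<otimes>\<^bsub>diag_clifford n Q\<^esub> generator j = blade {i, j}"
proof -
  have "{(a, b). a \<in> {i} \<and> b \<in> {j} \<and> b < a} = {}" "{i} \<inter> {j} = {}" using assms by auto
  then have "struct_const Q {i} {j} = 1"
    unfolding struct_const_def reorder_sign_def by (simp only:) simp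
  moreover have "sym_diff {i} {j} = {i, j}" using assms by auto
  moreover have "{i} \<subseteq> {1..n}" "{j} \<subseteq> {1..n}" using assms by auto
  ultimately show ?thesis
    using blade_mult[of "{i}" n "{j}" Q] unfolding generator_def blade_def
    by (simp add: diag_clifford_simps fun_eq_iff)
qed

section \<open>Coordinates of the symplectic form, the complex structure and the metric\<close>

lemma omega0_eq: "omega0 p = (\<lambda>A. \<Sum>k\<in>{1..p}. blade {k, k + p} A)"
proof -
  have "omega0 p = (\<lambda>A. \<Sum>k\<in>{1..p}. (generator k \<otimes>\<^bsub>exterior (2 * p)\<^esub> generator (k + p)) A)"
    unfolding omega0_def exterior_def
    by (rule diag_clifford_finsum) (auto simp: diag_clifford_mult_closed)
  also have "\<dots> = (\<lambda>A. \<Sum>k\<in>{1..p}. blade {k, k + p} A)"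
    unfolding exterior_def by (intro ext sum.cong refl) (subst generator_mult_blade, auto)
  finally show ?thesis .
qed

lemma omega0_closed: "omega0 p \<in> carrier (exterior (2 * p))"
  unfolding omega0_eq exterior_def diag_clifford_simps blade_def by (auto intro!: sum.neutral)

lemma J0_eq:
  "J0 p x i = (if i \<in> {1..p} then - x (i + p) else if i \<in> {p+1..2*p} then x (i - p) else 0)"
proof -
  have "J0 p x i = (\<Sum>k\<in>{1..p}. if k + p = i then x k else 0) - (\<Sum>k\<in>{1..p}. if k = i then x (k + p) else 0)"
    unfolding J0_def basis_vector_def sum_subtractf[symmetric] by (intro sum.cong refl) auto
  \<comment> \<open>Solving \<open>k + p = i\<close> for \<open>k\<close> gives a sum in delta form;
    the guard \<open>p \<le> i\<close> accounts for truncated subtraction.\<close>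
  moreover have "(\<Sum>k\<in>{1..p}. if k + p = i then x k else 0) =
      (\<Sum>k\<in>{1..p}. if k = i - p then if p \<le> i then x k else 0 else 0)"
    by (intro sum.cong refl) auto
  ultimately show ?thesis by (auto simp: sum.delta)
qed

lemma sum_double: "(\<Sum>i\<in>{1..2 * p}. h i) = (\<Sum>i\<in>{1..p}. h i) + (\<Sum>i\<in>{1..p}. h (i + p))" 
  for h :: "nat \<Rightarrow> real"
proof -
  have "{1..2 * p} = {1..p} \<union> {1 + p..p + p}" by auto
  then have "(\<Sum>i\<in>{1..2 * p}. h i) = (\<Sum>i\<in>{1..p}. h i) + (\<Sum>i\<in>{1 + p..p + p}. h i)"
    by (simp add: sum.union_disjoint)
  then show ?thesis by (simp only: sum.shift_bounds_cl_nat_ivl)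
qed

lemma g0_J0: "g0 p (J0 p x) y = (\<Sum>k\<in>{1..p}. x k * y (k + p) - x (k + p) * y k)"
proof -
  have "(\<Sum>i\<in>{1..p}. J0 p x i * y i) = (\<Sum>k\<in>{1..p}. - (x (k + p) * y k))"
    "(\<Sum>i\<in>{1..p}. J0 p x (i + p) * y (i + p)) = (\<Sum>k\<in>{1..p}. x k * y (k + p))"
    by (rule sum.cong; simp add: J0_eq)+
  then show ?thesis unfolding g0_def sum_double by (simp add: sum_subtractf sum_negf)
qed

lemma inner_product_g0: "inner_product (2 * p) (g0 p)"
  unfolding inner_product_def
proof (intro conjI ballI allI impI)
  fix x y z a b
  show "g0 p x y = g0 p y x" by (simp add: g0_def mult.commute)
  show "g0 p (\<lambda>i. a * x i + b * y i) z = a * g0 p x z + b * g0 p y z"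
    by (simp add: g0_def sum_distrib_left sum.distrib algebra_simps)
next
  fix x assume x: "x \<in> coord_space (2 * p)" "x \<noteq> (\<lambda>i. 0)"
  then obtain i where i: "x i \<noteq> 0" by auto
  then have "i \<in> {1..2*p}" using x unfolding coord_space_def by auto
  then show "g0 p x x > 0" unfolding g0_def using i
    by (intro sum_pos2[of _ i]) (auto simp: zero_less_mult_iff)
qed

text \<open>The evaluation runs over pairs \<open>i < j\<close>, so the coefficient
  \<open>{k, k + p}\<close> is met once, at \<open>i = k\<close> and \<open>j = k + p\<close>. The
  two inner sums are then contracted one after the other.\<close>

lemma eval_omega0:
  "eval_two_form (2 * p) (omega0 p) x y = (\<Sum>k\<in>{1..p}. x k * y (k + p) - x (k + p) * y k)"
proof -
  have "eval_two_form (2 * p) (omega0 p) x y = (\<Sum>j\<in>{1..2 * p}. \<Sum>i\<in>{1..<j}. \<Sum>k\<in>{1..p}.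
      if i = k \<and> j = k + p then x k * y (k + p) - x (k + p) * y k else 0)"
    unfolding eval_two_form_def omega0_eq sum_distrib_right blade_def
    by (intro sum.cong refl) (auto simp: doubleton_eq_iff)
  also have "\<dots> = (\<Sum>j\<in>{1..2 * p}. \<Sum>k\<in>{1..p}. \<Sum>i\<in>{1..<j}.
      if i = k then if j = k + p then x k * y (k + p) - x (k + p) * y k else 0 else 0)"
    by (intro sum.cong[OF refl] trans[OF sum.swap]) auto
  also have "\<dots> = (\<Sum>j\<in>{1..2 * p}. \<Sum>k\<in>{1..p}.
      if j = k + p then x k * y (k + p) - x (k + p) * y k else 0)"
    by (intro sum.cong refl) (auto simp: sum.delta)
  also have "\<dots> = (\<Sum>k\<in>{1..p}. \<Sum>j\<in>{1..2 * p}.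
      if j = k + p then x k * y (k + p) - x (k + p) * y k else 0)"
    by (rule sum.swap)
  also have "\<dots> = (\<Sum>k\<in>{1..p}. x k * y (k + p) - x (k + p) * y k)"
    by (intro sum.cong refl) (auto simp: sum.delta)
  finally show ?thesis .
qed

lemma unitary_structure_standard: "unitary_structure p (J0 p) (omega0 p) (g0 p)"
  unfolding unitary_structure_def
proof (intro conjI ballI)
  show "linear_endo (2 * p) (J0 p)"
    unfolding linear_endo_def coord_space_def by (auto simp: J0_eq fun_eq_iff)
  show "omega0 p \<in> two_forms (2 * p)"
    unfolding two_forms_def
  proof (intro CollectI conjI omega0_closed allI impI)
    fix A assume "omega0 p A \<noteq> 0"
    then obtain k where "k \<in> {1..p}" "blade {k, k + p} A \<noteq> 0"
      unfolding omega0_eq by (meson sum.not_neutral_contains_not_neutral)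
    then show "card A = 2" by (auto simp: blade_def split: if_splits)
  qed
  fix x assume x: "x \<in> coord_space (2 * p)"
  then show "J0 p (J0 p x) = (\<lambda>i. - x i)"
    by (auto simp: J0_eq fun_eq_iff coord_space_def)
  fix y assume y: "y \<in> coord_space (2 * p)"
  \<comment> \<open>By \<open>g0_J0\<close> with second argument \<open>J0 p y\<close>, this
    identity is the invariance of the metric under \<open>J0 p\<close>.\<close>
  have "(\<Sum>k\<in>{1..p}. x k * J0 p y (k + p) - x (k + p) * J0 p y k) =
      (\<Sum>k\<in>{1..p}. x k * y k + x (k + p) * y (k + p))"
    by (rule sum.cong) (auto simp: J0_eq)
  then show "g0 p (J0 p x) (J0 p y) = g0 p x y"
    unfolding g0_J0 by (simp only: g0_def sum_double sum.distrib)
  show "eval_two_form (2 * p) (omega0 p) x y = g0 p (J0 p x) y"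
    unfolding eval_omega0 g0_J0 ..
qed (rule inner_product_g0)

text \<open>Scalar multiplication is not a constructor of \<open>algebraic_expressions\<close>; it
  is recovered as the wedge product with a constant. Powers and the finite sum follow by
  induction.\<close>

lemma kahler_poly_algebraic: "kahler_poly n \<omega> \<in> algebraic_expressions (2 * n) {\<omega>}"
  if "\<omega> \<in> carrier (exterior (2 * n))"
proof -
  let ?E = "exterior (2 * n)" and ?X = "algebraic_expressions (2 * n) {\<omega>}"
  interpret E: ring ?E unfolding exterior_def by (rule ring_diag_clifford)
  have smult: "c \<odot>\<^bsub>?E\<^esub> x \<in> ?X" if "x \<in> ?X" "x \<in> carrier ?E" for c x
  proof -
    have "c \<odot>\<^bsub>?E\<^esub> x = (c \<odot>\<^bsub>?E\<^esub> \<one>\<^bsub>?E\<^esub>) \<otimes>\<^bsub>?E\<^esub> x"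
      using that E.l_one unfolding exterior_def by (simp add: diag_clifford_smult_mult)
    then show ?thesis using that by (simp add: algebraic_expressions.const algebraic_expressions.wedge)
  qed
  have scar: "c \<odot>\<^bsub>?E\<^esub> x \<in> carrier ?E" if "x \<in> carrier ?E" for c x
    using that by (simp add: exterior_def diag_clifford_simps)
  have one: "\<one>\<^bsub>?E\<^esub> \<in> ?X" and zero: "\<zero>\<^bsub>?E\<^esub> \<in> ?X"
    using algebraic_expressions.const[of "2 * n" 1] algebraic_expressions.const[of "2 * n" 0]
    by (simp_all add: exterior_def diag_clifford_simps)
  have pow: "\<omega> [^]\<^bsub>?E\<^esub> m \<in> ?X" for m :: nat
    by (induction m) (auto simp: one intro: algebraic_expressions.intros)
  have "(\<Oplus>\<^bsub>?E\<^esub>m\<in>I. (1 / fact m) \<odot>\<^bsub>?E\<^esub> (\<omega> [^]\<^bsub>?E\<^esub> m)) \<in> ?X" if "finite I" for I :: "nat set"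
    using that
  proof (induction I)
    case (insert i I)
    then show ?case using \<open>\<omega> \<in> carrier ?E\<close>
      by (subst E.finsum_insert) (auto simp: scar intro!: algebraic_expressions.plus smult pow)
  qed (simp add: zero)
  then show ?thesis unfolding kahler_poly_def
    by (intro smult) (auto intro!: E.finsum_closed scar that)
qed

section \<open>The exponential of the symplectic form\<close>

lemma mult_blade:
  assumes "B \<subseteq> {1..n}"
  shows "(x \<otimes>\<^bsub>diag_clifford n Q\<^esub> blade B) C =
    (if C \<subseteq> {1..n} then struct_const Q (sym_diff C B) B * x (sym_diff C B) else 0)"
proof (cases "C \<subseteq> {1..n}")
  case True
  have *: "sym_diff A C = B \<longleftrightarrow> A = sym_diff C B" for A by auto
  have "struct_const Q A (sym_diff A C) * x A * blade B (sym_diff A C) =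
      (if A = sym_diff C B then struct_const Q (sym_diff C B) B * x (sym_diff C B) else 0)" for A
  proof (cases "A = sym_diff C B")
    case True
    then have "sym_diff A C = B" by auto
    then show ?thesis using True by (simp add: blade_def)
  qed (simp add: blade_def *)
  moreover have "sym_diff C B \<in> Pow {1..n}" using True assms by auto
  ultimately show ?thesis using True unfolding diag_clifford_mult by (simp only: sum.delta) simp
qed (simp add: diag_clifford_mult)

lemma mult_coeff_empty:
  "(x \<otimes>\<^bsub>diag_clifford n Q\<^esub> y) {} = (\<Sum>A\<in>Pow {1..n}. struct_const Q A A * x A * y A)"
  unfolding diag_clifford_mult by simp

text \<open>Only equal blades contribute to the scalar part, so \<open>x\<close> and
  \<open>y\<close> enter symmetrically. The scalar part is therefore a trace, and factors can be
  rotated cyclically under it.\<close>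

lemma mult_coeff_empty_commute:
  "(x \<otimes>\<^bsub>diag_clifford n Q\<^esub> y) {} = (y \<otimes>\<^bsub>diag_clifford n Q\<^esub> x) {}"
  unfolding mult_coeff_empty by (simp add: mult_ac)

text \<open>The pairs in \<open>A \<times> B\<close> split into \<open>j < i\<close>,
  \<open>i < j\<close> and \<open>i = j\<close>. The first kind gives the reordering sign of
  \<open>e_A e_B\<close>, the second that of \<open>e_B e_A\<close>, and the third is counted by the
  intersection.\<close>

lemma struct_const_swap:
  assumes "finite A" "finite B"
  shows "struct_const Q A B = (-1) ^ (card A * card B + card (A \<inter> B)) * struct_const Q B A"
proof -
  let ?G = "{(i, j). i \<in> A \<and> j \<in> B \<and> j < i}" and ?L = "{(i, j). i \<in> A \<and> j \<in> B \<and> i < j}"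
    and ?D = "{(i, j). i \<in> A \<and> j \<in> B \<and> i = j}"
  have fin: "finite ?G" "finite ?L" "finite ?D"
    by (rule finite_subset[of _ "A \<times> B"]; use assms in auto)+
  have "A \<times> B = (?G \<union> ?L) \<union> ?D" by auto
  then have "card (A \<times> B) = card ((?G \<union> ?L) \<union> ?D)" by simp
  also have "\<dots> = card (?G \<union> ?L) + card ?D"
    using fin by (intro card_Un_disjoint) auto
  also have "card (?G \<union> ?L) = card ?G + card ?L"
    using fin by (intro card_Un_disjoint) auto
  also have "card ?L = card {(i, j). i \<in> B \<and> j \<in> A \<and> j < i}"
    by (rule bij_betw_same_card[of prod.swap]) (auto simp: bij_betw_def inj_on_def)
  also have "card ?D = card (A \<inter> B)"
    by (rule bij_betw_same_card[of fst]) (auto simp: bij_betw_def inj_on_def image_iff)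
  \<comment> \<open>The diagonal is added once more instead of being subtracted: the parity is the
    same and no natural number subtraction occurs.\<close>
  finally have c: "card A * card B + card (A \<inter> B) =
      card ?G + card {(i, j). i \<in> B \<and> j \<in> A \<and> j < i} + 2 * card (A \<inter> B)"
    by (simp add: card_cartesian_product)
  have sq: "(-1) ^ m * ((-1) ^ m * r) = (r::real)" for m :: nat and r
    by (simp add: power_add[symmetric] mult.assoc[symmetric])
  show ?thesis
    unfolding c struct_const_def reorder_sign_def
    by (simp add: power_add power_mult Int_commute sq mult.assoc mult.left_commute)
qed

lemma struct_const_nonzero:
  assumes "\<And>i. Q i \<noteq> 0"
  shows "struct_const Q A B \<noteq> 0"
proof (cases "finite (A \<inter> B)")
  case True
  then show ?thesis using assms by (simp add: struct_const_def reorder_sign_def)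
qed (simp add: struct_const_def reorder_sign_def)

lemma reorder_sign_singleton: "reorder_sign {i} {i} = 1"
  and reorder_sign_pair: "i < j \<Longrightarrow> reorder_sign {i, j} {i, j} = -1" for i j :: nat
proof -
  have "{(a, b). a \<in> {i} \<and> b \<in> {i} \<and> b < a} = {}" by auto
  then show "reorder_sign {i} {i} = 1" unfolding reorder_sign_def by (simp only:) simp
  assume "i < j"
  then have "{(a, b). a \<in> {i, j} \<and> b \<in> {i, j} \<and> b < a} = {(j, i)}" by auto
  then show "reorder_sign {i, j} {i, j} = -1" unfolding reorder_sign_def by (simp only:) simp
qed

text \<open>A pair has even cardinality, so in \<open>struct_const_swap\<close> only the overlap
  counts: \<open>e_A\<close> anticommutes with the pair exactly when it contains one of the two
  indices but not the other.\<close>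

lemma pair_blade_commute:
  assumes "1 \<le> k" "k \<le> p" "2 * p \<le> n" "A \<subseteq> {1..n}"
  shows "blade {k, k + p} \<otimes>\<^bsub>diag_clifford n Q\<^esub> blade A =
    (-1) ^ card (A \<inter> {k, k + p}) \<odot>\<^bsub>diag_clifford n Q\<^esub> (blade A \<otimes>\<^bsub>diag_clifford n Q\<^esub> blade {k, k + p})"
proof -
  have B: "{k, k + p} \<subseteq> {1..n}" and c: "card {k, k + p} = 2" using assms by auto
  have "sym_diff {k, k + p} A = sym_diff A {k, k + p}" by auto
  moreover have "struct_const Q {k, k + p} A = (-1) ^ card (A \<inter> {k, k + p}) * struct_const Q A {k, k + p}"
    by (subst struct_const_swap)
      (use finite_subset[OF assms(4)] in \<open>auto simp: c power_add power_mult Int_commute\<close>)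
  ultimately show ?thesis
    unfolding blade_mult[OF B assms(4)] blade_mult[OF assms(4) B]
    by (simp add: diag_clifford_simps mult.assoc)
qed

lemma pair_blades_commute:
  assumes "k \<in> {1..p}" "l \<in> {1..p}" "2 * p \<le> n"
  shows "blade {k, k + p} \<otimes>\<^bsub>diag_clifford n Q\<^esub> blade {l, l + p} =
    blade {l, l + p} \<otimes>\<^bsub>diag_clifford n Q\<^esub> blade {k, k + p}"
proof (cases "k = l")
  case False
  then have "{l, l + p} \<inter> {k, k + p} = {}" using assms by auto
  moreover have "{l, l + p} \<subseteq> {1..n}" using assms by auto
  ultimately show ?thesis
    using pair_blade_commute[of k p n "{l, l + p}" Q] assms by (simp add: diag_clifford_simps)
qed simp

text \<open>The product \<open>(1 + u 1) ... (1 + u j)\<close>. The algebra is a parameter so that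
  the wedge product and the Clifford product can be compared; \<open>p\<close> is the distance
  between partners and stays fixed while \<open>j\<close> grows.\<close>

primrec pair_prod :: "(real, multivector) module \<Rightarrow> nat \<Rightarrow> nat \<Rightarrow> multivector" where
  "pair_prod R p 0 = \<one>\<^bsub>R\<^esub>"
| "pair_prod R p (Suc j) = pair_prod R p j \<otimes>\<^bsub>R\<^esub> (\<one>\<^bsub>R\<^esub> \<oplus>\<^bsub>R\<^esub> blade {Suc j, Suc j + p})"

lemma pair_prod_closed:
  "pair_prod (diag_clifford n Q) p j \<in> carrier (diag_clifford n Q)"
  by (cases j) (simp_all only: pair_prod.simps diag_clifford_mult_closed
      blade_closed[OF empty_subsetI] flip: blade_empty)

text \<open>The new pair is disjoint from all indices used so far, so no generator is squared and
  the structure constant reduces to a reordering sign. The resulting recursion involves neither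
  \<open>n\<close> nor \<open>Q\<close>.\<close>

lemma pair_prod_Suc_coeff:
  assumes "Suc j \<le> p" "2 * p \<le> n"
    and supp: "\<forall>A. pair_prod (diag_clifford n Q) p j A \<noteq> 0 \<longrightarrow> A \<subseteq> {1..j} \<union> {p + 1..p + j}"
  shows "pair_prod (diag_clifford n Q) p (Suc j) = (\<lambda>C. pair_prod (diag_clifford n Q) p j C +
    reorder_sign (sym_diff C {Suc j, Suc j + p}) {Suc j, Suc j + p} *
      pair_prod (diag_clifford n Q) p j (sym_diff C {Suc j, Suc j + p}))"
proof
  fix C
  let ?R = "diag_clifford n Q" and ?B = "{Suc j, Suc j + p}"
  let ?P = "pair_prod ?R p j"
  interpret ring ?R by (rule ring_diag_clifford)
  have B: "?B \<subseteq> {1..n}" using assms by auto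
  have "pair_prod ?R p (Suc j) = ?P \<oplus>\<^bsub>?R\<^esub> ?P \<otimes>\<^bsub>?R\<^esub> blade ?B"
    using pair_prod_closed blade_closed[OF B] by (simp add: r_distr)
  then have "pair_prod ?R p (Suc j) C = ?P C + (?P \<otimes>\<^bsub>?R\<^esub> blade ?B) C"
    by (simp add: diag_clifford_simps)
  also have "(?P \<otimes>\<^bsub>?R\<^esub> blade ?B) C = reorder_sign (sym_diff C ?B) ?B * ?P (sym_diff C ?B)"
  proof (cases "?P (sym_diff C ?B) = 0")
    case True
    then show ?thesis unfolding mult_blade[OF B] by simp
  next
    case False
    then have s: "sym_diff C ?B \<subseteq> {1..j} \<union> {p + 1..p + j}" using supp by blast
    then have d: "sym_diff C ?B \<inter> ?B = {}" using assms by auto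
    have "sym_diff C ?B \<subseteq> {1..n}" using s assms by auto
    then have "C \<subseteq> {1..n}" using B by blast
    then show ?thesis unfolding mult_blade[OF B] struct_const_def d by simp
  qed
  finally show "pair_prod ?R p (Suc j) C = ?P C +
      reorder_sign (sym_diff C ?B) ?B * ?P (sym_diff C ?B)" .
qed

text \<open>This supplies the hypothesis \<open>supp\<close> of the recursion; the inductive step
  itself uses the recursion with the support known one stage earlier.\<close>

lemma pair_prod_support:
  assumes "j \<le> p" "2 * p \<le> n" "pair_prod (diag_clifford n Q) p j A \<noteq> 0"
  shows "A \<subseteq> {1..j} \<union> {p + 1..p + j}"
  using assms
proof (induction j arbitrary: A)
  case (Suc j)
  have supp: "\<forall>A. pair_prod (diag_clifford n Q) p j A \<noteq> 0 \<longrightarrow> A \<subseteq> {1..j} \<union> {p + 1..p + j}"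
    using Suc.IH Suc.prems by simp
  let ?B = "{Suc j, Suc j + p}"
  have "pair_prod (diag_clifford n Q) p j A \<noteq> 0 \<or> pair_prod (diag_clifford n Q) p j (sym_diff A ?B) \<noteq> 0"
    using Suc.prems unfolding pair_prod_Suc_coeff[OF Suc.prems(1,2) supp] by force
  then have "A \<subseteq> {1..j} \<union> {p + 1..p + j} \<or> sym_diff A ?B \<subseteq> {1..j} \<union> {p + 1..p + j}"
    using supp by blast
  then have "A \<subseteq> {1..j} \<union> {p + 1..p + j} \<union> ?B" by blast
  also have "\<dots> \<subseteq> {1..Suc j} \<union> {p + 1..p + Suc j}" by auto
  finally show ?case .
qed (auto simp: diag_clifford_simps split: if_splits)

text \<open>Both sides obey the same recursion with the same start. With \<open>Q = 0\<close> on one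
  side, this turns a wedge product into a Clifford product.\<close>

lemma pair_prod_cong:
  assumes "j \<le> p" "2 * p \<le> n" "2 * p \<le> m"
  shows "pair_prod (diag_clifford n Q) p j = pair_prod (diag_clifford m S) p j"
  using assms
proof (induction j)
  case (Suc j)
  have "A \<subseteq> {1..j} \<union> {p + 1..p + j}" if "pair_prod (diag_clifford n' Q') p j A \<noteq> 0" "2 * p \<le> n'"
    for A n' Q'
    using pair_prod_support[OF _ that(2,1)] Suc.prems by simp
  then show ?case using Suc
    by (subst (1 2) pair_prod_Suc_coeff) auto
qed (simp add: diag_clifford_simps)

text \<open>Only the summand 1 of each factor reaches the scalar part. This is what makes the
  idempotent nonzero.\<close>

lemma pair_prod_coeff_empty:
  assumes "j \<le> p" "2 * p \<le> n"
  shows "pair_prod (diag_clifford n Q) p j {} = 1"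
  using assms
proof (induction j)
  case (Suc j)
  let ?B = "{Suc j, Suc j + p}"
  have supp: "\<forall>A. pair_prod (diag_clifford n Q) p j A \<noteq> 0 \<longrightarrow> A \<subseteq> {1..j} \<union> {p + 1..p + j}"
    using pair_prod_support[OF _ Suc.prems(2)] Suc.prems(1) by (meson Suc_leD)
  have "\<not> ?B \<subseteq> {1..j} \<union> {p + 1..p + j}" using Suc.prems by auto
  then have "pair_prod (diag_clifford n Q) p j ?B = 0" using supp by blast
  then show ?case using Suc
    by (simp add: pair_prod_Suc_coeff[OF Suc.prems supp] del: pair_prod.simps(2))
qed (simp add: diag_clifford_simps)

text \<open>The binomial expansion for commuting \<open>a\<close> and \<open>v\<close>, cut off
  after the linear term because \<open>v\<close> squares to zero.\<close>

lemma diag_clifford_power_Suc_add: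
  fixes n Q
  defines "R \<equiv> diag_clifford n Q"
  assumes a: "a \<in> carrier R" and v: "v \<in> carrier R" and comm: "v \<otimes>\<^bsub>R\<^esub> a = a \<otimes>\<^bsub>R\<^esub> v"
    and sq: "v \<otimes>\<^bsub>R\<^esub> v = \<zero>\<^bsub>R\<^esub>"
  shows "(a \<oplus>\<^bsub>R\<^esub> v) [^]\<^bsub>R\<^esub> Suc m =
    a [^]\<^bsub>R\<^esub> Suc m \<oplus>\<^bsub>R\<^esub> real (Suc m) \<odot>\<^bsub>R\<^esub> (a [^]\<^bsub>R\<^esub> m \<otimes>\<^bsub>R\<^esub> v)"
proof -
  interpret ring R unfolding R_def by (rule ring_diag_clifford)
  have sc: "c \<odot>\<^bsub>R\<^esub> x \<in> carrier R" if "x \<in> carrier R" for c x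
    using that by (simp add: R_def diag_clifford_simps)
  show ?thesis
  proof (induction m)
    case 0
    show ?case using a v by simp (simp add: R_def diag_clifford_simps)
  next
    case (Suc m)
    let ?w = "a [^]\<^bsub>R\<^esub> m \<otimes>\<^bsub>R\<^esub> v"
    have w: "?w \<in> carrier R" using a v by simp
    have wa: "?w \<otimes>\<^bsub>R\<^esub> a = a [^]\<^bsub>R\<^esub> Suc m \<otimes>\<^bsub>R\<^esub> v"
      using a v comm by (simp add: m_assoc)
    have wv: "?w \<otimes>\<^bsub>R\<^esub> v = \<zero>\<^bsub>R\<^esub>" using a v sq by (simp add: m_assoc)
    have "(a \<oplus>\<^bsub>R\<^esub> v) [^]\<^bsub>R\<^esub> Suc (Suc m) =
        (a [^]\<^bsub>R\<^esub> Suc m \<oplus>\<^bsub>R\<^esub> real (Suc m) \<odot>\<^bsub>R\<^esub> ?w) \<otimes>\<^bsub>R\<^esub> (a \<oplus>\<^bsub>R\<^esub> v)"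
      using Suc by simp
    also have "\<dots> = (a [^]\<^bsub>R\<^esub> Suc m \<otimes>\<^bsub>R\<^esub> a \<oplus>\<^bsub>R\<^esub> a [^]\<^bsub>R\<^esub> Suc m \<otimes>\<^bsub>R\<^esub> v) \<oplus>\<^bsub>R\<^esub>
        (real (Suc m) \<odot>\<^bsub>R\<^esub> (?w \<otimes>\<^bsub>R\<^esub> a) \<oplus>\<^bsub>R\<^esub> real (Suc m) \<odot>\<^bsub>R\<^esub> (?w \<otimes>\<^bsub>R\<^esub> v))"
    proof -
      have sm: "(real (Suc m) \<odot>\<^bsub>R\<^esub> ?w) \<otimes>\<^bsub>R\<^esub> y = real (Suc m) \<odot>\<^bsub>R\<^esub> (?w \<otimes>\<^bsub>R\<^esub> y)" for y
        unfolding R_def by (rule diag_clifford_smult_mult)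
      have "a [^]\<^bsub>R\<^esub> Suc m \<in> carrier R" using a by (rule nat_pow_closed)
      then show ?thesis
        using a v w sc[OF w, of "real (Suc m)"] unfolding sm[symmetric]
        by (subst l_distr) (simp_all only: r_distr a_closed)
    qed
    also have "\<dots> = a [^]\<^bsub>R\<^esub> Suc (Suc m) \<oplus>\<^bsub>R\<^esub> real (Suc (Suc m)) \<odot>\<^bsub>R\<^esub> (a [^]\<^bsub>R\<^esub> Suc m \<otimes>\<^bsub>R\<^esub> v)"
      unfolding wa wv nat_pow_Suc[of _ "Suc m"]
      by (simp add: R_def diag_clifford_simps algebra_simps)
    finally show ?case .
  qed
qed

text \<open>For commuting \<open>w\<close> and \<open>v\<close> with \<open>v\<close> of square
  zero, \<open>exp (w + v) = exp w (1 + v)\<close>; this is applied once for each pair. The series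
  may stop at \<open>m = j\<close> since a sum of \<open>j\<close> commuting elements of square zero
  has vanishing power \<open>Suc j\<close>.\<close>

lemma exterior_exp_eq_pair_prod:
  fixes p
  defines "E \<equiv> exterior (2 * p)"
  assumes "j \<le> p"
  shows "(\<lambda>A. \<Sum>m\<le>j. (1 / fact m) * ((\<lambda>A. \<Sum>k\<in>{1..j}. blade {k, k + p} A) [^]\<^bsub>E\<^esub> m) A) = pair_prod E p j"
proof -
  define w where "w j = (\<lambda>A. \<Sum>k\<in>{1..j}. blade {k, k + p} A)" for j
  have E: "E = diag_clifford (2 * p) (\<lambda>i. 0)" unfolding E_def exterior_def ..
  interpret ring E unfolding E by (rule ring_diag_clifford)
  let ?v = "\<lambda>k. blade {k, k + p}"
  have w0: "w 0 = \<zero>\<^bsub>E\<^esub>" and wS: "w (Suc j) = w j \<oplus>\<^bsub>E\<^esub> ?v (Suc j)" for j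
    by (simp_all add: w_def E diag_clifford_simps)
  have v: "?v k \<in> carrier E" if "k \<in> {1..p}" for k
    unfolding E by (rule blade_closed) (use that in auto)
  have wc: "w j \<in> carrier E" if "j \<le> p" for j
    using that
  proof (induction j)
    case (Suc j)
    then show ?case using v[of "Suc j"] by (simp add: wS)
  qed (simp add: w0)
  have comm: "?v k \<otimes>\<^bsub>E\<^esub> w j = w j \<otimes>\<^bsub>E\<^esub> ?v k" if "k \<in> {1..p}" "j \<le> p" for j k
    using that(2)
  proof (induction j)
    case (Suc j)
    then show ?case
      using pair_blades_commute[of k p "Suc j" "2 * p" "\<lambda>i. 0"] that(1) v[of "Suc j"]
      by (simp add: wS l_distr r_distr wc v E[symmetric])
  qed (use that in \<open>simp add: w0 v\<close>)
  have sq: "?v k \<otimes>\<^bsub>E\<^esub> ?v k = \<zero>\<^bsub>E\<^esub>" if "k \<in> {1..p}" for k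
  proof -
    have B: "{k, k + p} \<subseteq> {1..2 * p}" and c: "card {k, k + p} = 2" using that by auto
    show ?thesis unfolding E blade_mult[OF B B]
      by (simp add: struct_const_def diag_clifford_simps c)
  qed
  have pow: "w (Suc j) [^]\<^bsub>E\<^esub> Suc m =
      w j [^]\<^bsub>E\<^esub> Suc m \<oplus>\<^bsub>E\<^esub> real (Suc m) \<odot>\<^bsub>E\<^esub> (w j [^]\<^bsub>E\<^esub> m \<otimes>\<^bsub>E\<^esub> ?v (Suc j))"
    if "Suc j \<le> p" for j m
    unfolding wS unfolding E
    by (rule diag_clifford_power_Suc_add; unfold E[symmetric])
      (use that v[of "Suc j"] comm[of "Suc j" j] sq[of "Suc j"] in \<open>auto intro!: wc\<close>)
  have scz: "c \<odot>\<^bsub>E\<^esub> \<zero>\<^bsub>E\<^esub> = \<zero>\<^bsub>E\<^esub>" for c by (simp add: E diag_clifford_simps)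
  \<comment> \<open>In the expansion of the power \<open>Suc (Suc j)\<close> of
    \<open>w (Suc j)\<close>, both terms contain the factor \<open>w j [^] Suc j\<close>, which is
    zero by induction.\<close>
  have nil: "w j [^]\<^bsub>E\<^esub> Suc j = \<zero>\<^bsub>E\<^esub>" if "j \<le> p" for j
    using that
  proof (induction j)
    case (Suc j)
    have z: "w j [^]\<^bsub>E\<^esub> Suc j = \<zero>\<^bsub>E\<^esub>" using Suc by simp
    have "w j [^]\<^bsub>E\<^esub> Suc (Suc j) = \<zero>\<^bsub>E\<^esub>"
      using Suc.prems wc[of j] z by (simp only: nat_pow_Suc[of _ "Suc j"] l_null)
    then show ?case unfolding pow[OF Suc.prems] z using v[of "Suc j"] Suc.prems
      by (simp only: l_null scz) (simp add: l_null scz)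
  qed (simp add: w0)
  have "(\<lambda>A. \<Sum>m\<le>j. (1 / fact m) * (w j [^]\<^bsub>E\<^esub> m) A) = pair_prod E p j" if "j \<le> p" for j
    using that
  proof (induction j)
    case (Suc j)
    let ?T = "\<lambda>A. \<Sum>m\<le>j. (1 / fact m) * (w j [^]\<^bsub>E\<^esub> m) A"
    have IH: "?T = pair_prod E p j" using Suc by simp
    have B: "{Suc j, Suc j + p} \<subseteq> {1..2 * p}" using Suc.prems by auto
    have Tv: "(?T \<otimes>\<^bsub>E\<^esub> ?v (Suc j)) A =
        (\<Sum>m\<le>j. (1 / fact m) * (w j [^]\<^bsub>E\<^esub> m \<otimes>\<^bsub>E\<^esub> ?v (Suc j)) A)" for A
      unfolding E mult_blade[OF B] by (simp add: sum_distrib_left mult_ac)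
    \<comment> \<open>Nilpotency allows one more, vanishing, term in the series for
      \<open>w j\<close>. After the shift of the index it has the same range as the series for
      \<open>w (Suc j)\<close>.\<close>
    have T: "?T A = \<one>\<^bsub>E\<^esub> A + (\<Sum>m\<le>j. (1 / fact (Suc m)) * (w j [^]\<^bsub>E\<^esub> Suc m) A)" for A
    proof -
      have "(\<Sum>m\<le>Suc j. (1 / fact m) * (w j [^]\<^bsub>E\<^esub> m) A) = ?T A"
        using nil[of j] Suc.prems by (simp only: sum.atMost_Suc) (simp add: E diag_clifford_simps)
      then show ?thesis by (simp only: sum.atMost_Suc_shift) simp
    qed
    have "(\<Sum>m\<le>Suc j. (1 / fact m) * (w (Suc j) [^]\<^bsub>E\<^esub> m) A) = (?T \<oplus>\<^bsub>E\<^esub> ?T \<otimes>\<^bsub>E\<^esub> ?v (Suc j)) A" for A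
    proof -
      have "(\<Sum>m\<le>Suc j. (1 / fact m) * (w (Suc j) [^]\<^bsub>E\<^esub> m) A) =
          \<one>\<^bsub>E\<^esub> A + (\<Sum>m\<le>j. (1 / fact (Suc m)) * (w (Suc j) [^]\<^bsub>E\<^esub> Suc m) A)"
        by (simp only: sum.atMost_Suc_shift) simp
      also have "(\<Sum>m\<le>j. (1 / fact (Suc m)) * (w (Suc j) [^]\<^bsub>E\<^esub> Suc m) A) =
          (\<Sum>m\<le>j. (1 / fact (Suc m)) * (w j [^]\<^bsub>E\<^esub> Suc m) A +
            (1 / fact m) * (w j [^]\<^bsub>E\<^esub> m \<otimes>\<^bsub>E\<^esub> ?v (Suc j)) A)"
      proof (rule sum.cong[OF refl])
        fix m
        have add: "(x \<oplus>\<^bsub>E\<^esub> c \<odot>\<^bsub>E\<^esub> y) A = x A + c * y A" for x y c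
          by (simp add: E diag_clifford_simps)
        \<comment> \<open>The binomial factor \<open>Suc m\<close> lowers the factorial, so the
          linear terms again form an exponential series.\<close>
        have "(1 / fact (Suc m)) * (real (Suc m) * r) = (1 / fact m) * r" for r
          by (simp add: field_simps del: of_nat_Suc)
        then show "(1 / fact (Suc m)) * (w (Suc j) [^]\<^bsub>E\<^esub> Suc m) A =
          (1 / fact (Suc m)) * (w j [^]\<^bsub>E\<^esub> Suc m) A + (1 / fact m) * (w j [^]\<^bsub>E\<^esub> m \<otimes>\<^bsub>E\<^esub> ?v (Suc j)) A"
          unfolding pow[OF Suc.prems] add distrib_left by simp
      qed
      also have "\<one>\<^bsub>E\<^esub> A + \<dots> = ?T A + (?T \<otimes>\<^bsub>E\<^esub> ?v (Suc j)) A"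
        using T[of A] unfolding Tv sum.distrib by simp
      finally show ?thesis by (simp add: E diag_clifford_simps)
    qed
    moreover have "pair_prod E p j \<oplus>\<^bsub>E\<^esub> pair_prod E p j \<otimes>\<^bsub>E\<^esub> ?v (Suc j) = pair_prod E p (Suc j)"
      using pair_prod_closed[of "2 * p" "\<lambda>i. 0" p j] v[of "Suc j"] Suc.prems
      by (simp add: r_distr E[symmetric])
    ultimately show ?case unfolding IH by auto
  qed (simp add: w0 E diag_clifford_simps)
  then show "(\<lambda>A. \<Sum>m\<le>j. (1 / fact m) * ((\<lambda>A. \<Sum>k\<in>{1..j}. blade {k, k + p} A) [^]\<^bsub>E\<^esub> m) A) = pair_prod E p j"
    using assms unfolding w_def by auto
qed

lemma kahler_poly_omega0:
  "kahler_poly p (omega0 p) = (\<lambda>A. (1 / 2 ^ p) * pair_prod (exterior (2 * p)) p p A)"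
proof -
  let ?E = "exterior (2 * p)"
  interpret E: ring ?E unfolding exterior_def by (rule ring_diag_clifford)
  have "(\<Oplus>\<^bsub>?E\<^esub>m\<in>{0..p}. (1 / fact m) \<odot>\<^bsub>?E\<^esub> (omega0 p [^]\<^bsub>?E\<^esub> m)) =
      (\<lambda>A. \<Sum>m\<in>{0..p}. ((1 / fact m) \<odot>\<^bsub>?E\<^esub> (omega0 p [^]\<^bsub>?E\<^esub> m)) A)"
    using E.nat_pow_closed[OF omega0_closed] unfolding exterior_def
    by (intro diag_clifford_finsum) (auto simp: diag_clifford_simps)
  also have "\<dots> = pair_prod ?E p p"
    unfolding exterior_exp_eq_pair_prod[OF order_refl, symmetric] omega0_eq[symmetric] atMost_atLeast0
    by (simp add: exterior_def diag_clifford_simps)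
  finally show ?thesis unfolding kahler_poly_def by (simp add: exterior_def diag_clifford_simps)
qed

text \<open>Quantization preserves coefficients, and \<open>pair_prod_cong\<close> then transports
  the product from the exterior to the Clifford algebra.\<close>

lemma f_U_eq:
  assumes "p \<le> s"
  shows "f_U p s = (1 / 2 ^ p) \<odot>\<^bsub>clifford p s\<^esub> pair_prod (clifford p s) p p"
proof -
  have "kahler_poly p (omega0 p) \<in> carrier (exterior (2 * p))"
    using pair_prod_closed[of "2 * p" "\<lambda>i. 0" p p]
    unfolding kahler_poly_omega0 exterior_def by (simp add: diag_clifford_simps)
  then have "f_U p s = kahler_poly p (omega0 p)"
    unfolding f_U_def using assms by (intro quantization_coeffs) auto
  also have "\<dots> = (\<lambda>A. (1 / 2 ^ p) * pair_prod (clifford p s) p p A)"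
    unfolding kahler_poly_omega0 exterior_def clifford_def
    using assms by (subst pair_prod_cong[of p p "2 * p" "p + s"]) auto
  finally show ?thesis by (simp add: clifford_def diag_clifford_simps)
qed

section \<open>The corner of the idempotent\<close>

lemma diag_clifford_smult_closed:
  "x \<in> carrier (diag_clifford n Q) \<Longrightarrow> c \<odot>\<^bsub>diag_clifford n Q\<^esub> x \<in> carrier (diag_clifford n Q)"
  by (simp add: diag_clifford_simps)

text \<open>The element is built up one coefficient at a time, as its restrictions to growing
  families of index sets.\<close>

lemma diag_clifford_blade_induct:
  assumes y: "y \<in> carrier (diag_clifford n Q)"
    and zero: "Pr \<zero>\<^bsub>diag_clifford n Q\<^esub>"
    and add: "\<And>x A c. x \<in> carrier (diag_clifford n Q) \<Longrightarrow> A \<subseteq> {1..n} \<Longrightarrow> Pr x \<Longrightarrow>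
      Pr (x \<oplus>\<^bsub>diag_clifford n Q\<^esub> c \<odot>\<^bsub>diag_clifford n Q\<^esub> blade A)"
  shows "Pr y"
proof -
  have "Pr (\<lambda>A. if A \<in> F then y A else 0)" if "finite F" "F \<subseteq> Pow {1..n}" for F
    using that
  proof (induction F)
    case (insert A F)
    have "(\<lambda>B. if B \<in> insert A F then y B else 0) =
        (\<lambda>B. if B \<in> F then y B else 0) \<oplus>\<^bsub>diag_clifford n Q\<^esub> y A \<odot>\<^bsub>diag_clifford n Q\<^esub> blade A"
      using insert by (auto simp: diag_clifford_simps blade_def fun_eq_iff)
    moreover have "(\<lambda>B. if B \<in> F then y B else 0) \<in> carrier (diag_clifford n Q)"
      using insert by (auto simp: diag_clifford_simps)
    ultimately show ?case using insert by (simp add: add)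
  qed (use zero in \<open>simp add: diag_clifford_simps\<close>)
  from this[of "Pow {1..n}"] have "Pr (\<lambda>A. if A \<in> Pow {1..n} then y A else 0)" by simp
  moreover have "(\<lambda>A. if A \<in> Pow {1..n} then y A else 0) = y"
    using y by (auto simp: diag_clifford_simps fun_eq_iff)
  ultimately show ?thesis by simp
qed

text \<open>Choose \<open>A\<close> with \<open>x A\<close> nonzero and let \<open>a = e_A\<close>.
  By cyclicity the scalar part of \<open>f e_A x\<close> is that of \<open>e_A x f = e_A x\<close>,
  a nonzero multiple of \<open>x A\<close>.\<close>

lemma diag_clifford_nondegenerate:
  assumes Q: "\<And>i. Q i \<noteq> 0" and x: "x \<in> carrier (diag_clifford n Q)" "x \<noteq> \<zero>\<^bsub>diag_clifford n Q\<^esub>"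
    and f: "f \<in> carrier (diag_clifford n Q)" "x \<otimes>\<^bsub>diag_clifford n Q\<^esub> f = x"
  shows "\<exists>a\<in>carrier (diag_clifford n Q).
    f \<otimes>\<^bsub>diag_clifford n Q\<^esub> a \<otimes>\<^bsub>diag_clifford n Q\<^esub> x \<noteq> \<zero>\<^bsub>diag_clifford n Q\<^esub>"
proof -
  let ?R = "diag_clifford n Q"
  interpret ring ?R by (rule ring_diag_clifford)
  obtain A where A: "x A \<noteq> 0" using x by (auto simp: diag_clifford_simps fun_eq_iff)
  then have sub: "A \<subseteq> {1..n}" using x by (auto simp: diag_clifford_simps)
  have b: "blade A \<in> carrier ?R" by (rule blade_closed[OF sub])
  have "(f \<otimes>\<^bsub>?R\<^esub> blade A \<otimes>\<^bsub>?R\<^esub> x) {} = (blade A \<otimes>\<^bsub>?R\<^esub> x \<otimes>\<^bsub>?R\<^esub> f) {}"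
    using mult_coeff_empty_commute[of n Q f "blade A \<otimes>\<^bsub>?R\<^esub> x"] b x f by (simp add: m_assoc)
  also have "\<dots> = (x \<otimes>\<^bsub>?R\<^esub> blade A) {}"
    using mult_coeff_empty_commute[of n Q "blade A" x] b x f by (simp add: m_assoc)
  also have "\<dots> = struct_const Q A A * x A" unfolding mult_blade[OF sub] by simp
  finally have "(f \<otimes>\<^bsub>?R\<^esub> blade A \<otimes>\<^bsub>?R\<^esub> x) {} \<noteq> 0" using A struct_const_nonzero[of Q] Q by simp
  then have "f \<otimes>\<^bsub>?R\<^esub> blade A \<otimes>\<^bsub>?R\<^esub> x \<noteq> \<zero>\<^bsub>?R\<^esub>" by (auto simp: diag_clifford_simps)
  then show ?thesis using b by blast
qed

text \<open>The two sides are the coefficients of \<open>conj(e_A) e_B\<close> and, up to sign,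
  \<open>conj(e_B) e_A\<close>. They cancel as in the quaternions: nonscalar blades square to -1 and
  distinct ones anticommute.\<close>

lemma struct_const_conj_antisym:
  assumes Q: "Q a = -1" "Q b = -1" and "a < b"
    and AB: "A \<subseteq> {a, b}" "B \<subseteq> {a, b}" "A \<noteq> B"
  shows "struct_const Q A B * struct_const Q A A = - (struct_const Q B A * struct_const Q B B)"
proof -
  have cases: "X = {} \<or> X = {a} \<or> X = {b} \<or> X = {a, b}" if "X \<subseteq> {a, b}" for X using that by auto
  have sq: "struct_const Q X X = (if X = {} then 1 else -1)" if "X \<subseteq> {a, b}" for X
    using cases[OF that] Q \<open>a < b\<close>
    by (cases "X = {}") (auto simp: struct_const_def[of _ "insert _ _"] reorder_sign_singleton reorder_sign_pair)
  show ?thesis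
  proof (cases "A = {} \<or> B = {}")
    case True
    then show ?thesis using AB by (auto simp: sq)
  next
    case False
    have fin: "finite A" "finite B" using AB finite_subset by blast+
    have "odd (card A * card B + card (A \<inter> B))"
      using cases[OF AB(1)] cases[OF AB(2)] AB(3) False \<open>a < b\<close> by auto
    then have "struct_const Q A B = - struct_const Q B A"
      unfolding struct_const_swap[OF fin] by simp
    then show ?thesis using AB False by (simp add: sq)
  qed
qed

text \<open>On the span of the products of at most two negative generators (the reals, the complex
  numbers or the quaternions), \<open>A \<mapsto> struct_const Q A A * x A\<close> is the conjugate of \<open>x\<close>.\<close>

lemma diag_clifford_conj_mult:
  fixes x :: multivector
  assumes Q: "Q a = -1" "Q b = -1" and "a < b"
    and supp: "\<And>A. x A \<noteq> 0 \<Longrightarrow> A \<subseteq> {a, b}"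
  shows "(\<lambda>A. struct_const Q A A * x A) \<otimes>\<^bsub>diag_clifford n Q\<^esub> x =
    (\<Sum>A\<in>Pow {1..n}. (struct_const Q A A * x A)\<^sup>2) \<odot>\<^bsub>diag_clifford n Q\<^esub> \<one>\<^bsub>diag_clifford n Q\<^esub>"
proof
  fix C
  let ?k = "struct_const Q"
  define g where "g A = ?k A (sym_diff A C) * (?k A A * x A) * x (sym_diff A C)" for A
  have mult: "((\<lambda>A. ?k A A * x A) \<otimes>\<^bsub>diag_clifford n Q\<^esub> x) C =
      (if C \<subseteq> {1..n} then \<Sum>A\<in>Pow {1..n}. g A else 0)"
    unfolding diag_clifford_mult g_def ..
  consider "C = {}" | "C \<noteq> {}" "C \<subseteq> {1..n}" | "\<not> C \<subseteq> {1..n}" by auto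
  then show "((\<lambda>A. ?k A A * x A) \<otimes>\<^bsub>diag_clifford n Q\<^esub> x) C =
    ((\<Sum>A\<in>Pow {1..n}. (?k A A * x A)\<^sup>2) \<odot>\<^bsub>diag_clifford n Q\<^esub> \<one>\<^bsub>diag_clifford n Q\<^esub>) C"
  proof cases
    case 1
    then show ?thesis unfolding mult
      by (simp add: g_def diag_clifford_simps power2_eq_square mult_ac)
  next
    case 2
    \<comment> \<open>The involution sending \<open>A\<close> to \<open>sym_diff A C\<close> pairs
      the contributions to \<open>e_C\<close> with opposite signs, so every nonscalar coefficient
      vanishes.\<close>
    have anti: "g (sym_diff A C) = - g A" for A
    proof -
      let ?B = "sym_diff A C"
      have e: "sym_diff ?B C = A" by auto
      have ne: "A \<noteq> ?B" using 2 by auto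
      show ?thesis
      proof (cases "x A = 0 \<or> x ?B = 0")
        case False
        then have "?k A ?B * ?k A A = - (?k ?B A * ?k ?B ?B)"
          using struct_const_conj_antisym[OF assms(1-3) _ _ ne] supp by blast
        from arg_cong[OF this, of "\<lambda>t. - t * (x A * x ?B)"] show ?thesis
          unfolding g_def e by (simp only: mult_ac mult_minus_left mult_minus_right minus_minus)
      qed (auto simp only: g_def e mult_zero_left mult_zero_right minus_zero)
    qed
    have "(\<Sum>A\<in>Pow {1..n}. g A) = (\<Sum>A\<in>Pow {1..n}. g (sym_diff A C))"
      by (rule sum.reindex_bij_witness[where i = "\<lambda>A. sym_diff A C" and j = "\<lambda>A. sym_diff A C"])
        (use 2 in \<open>auto intro!: arg_cong[of _ _ g]\<close>)
    then have "(\<Sum>A\<in>Pow {1..n}. g A) = 0" unfolding anti sum_negf by simp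
    then show ?thesis using 2 unfolding mult by (simp add: diag_clifford_simps)
  qed (auto simp: mult diag_clifford_simps)
qed

section \<open>The element \<open>f_U p s\<close> for the three signatures at once\<close>

context
  fixes p s :: nat
  assumes ps: "p \<le> s" "s \<le> p + 2"
begin

abbreviation (input) "R \<equiv> clifford p s"
abbreviation (input) "u k \<equiv> blade {k, k + p}"

lemma ring_clifford: "ring R" unfolding clifford_def by (rule ring_diag_clifford)

lemma pair_subset: "k \<in> {1..p} \<Longrightarrow> {k, k + p} \<subseteq> {1..p + s}" using ps by auto

lemma cl_blade_closed: "A \<subseteq> {1..p + s} \<Longrightarrow> blade A \<in> carrier R"
  unfolding clifford_def by (rule blade_closed)

lemma u_closed: "k \<in> {1..p} \<Longrightarrow> u k \<in> carrier R"
  by (rule cl_blade_closed[OF pair_subset])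

lemma cl_pair_prod_closed: "pair_prod R p j \<in> carrier R"
  unfolding clifford_def by (rule pair_prod_closed)

lemma cl_smult_closed: "x \<in> carrier R \<Longrightarrow> c \<odot>\<^bsub>R\<^esub> x \<in> carrier R"
  unfolding clifford_def by (rule diag_clifford_smult_closed)

lemmas cl_smult_mult = diag_clifford_smult_mult[where n = "p + s" and Q = "\<lambda>i. if i \<le> p then 1 else -1", folded clifford_def]
lemmas cl_simps = diag_clifford_simps[where n = "p + s" and Q = "\<lambda>i. if i \<le> p then 1 else -1", folded clifford_def]

lemmas cl_blade_induct = diag_clifford_blade_induct[where n = "p + s" and
    Q = "\<lambda>i. if i \<le> p then 1 else -1", folded clifford_def, consumes 1, case_names zero add]

lemma cl_zero_coeff: "\<zero>\<^bsub>R\<^esub> B = (0 :: real)" by (simp add: cl_simps)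

text \<open>The reordering sign -1 cancels against the squares of \<open>e_k\<close> and
  \<open>e_{k+p}\<close>, which are 1 and -1.\<close>

lemma u_square:
  assumes "k \<in> {1..p}"
  shows "u k \<otimes>\<^bsub>R\<^esub> u k = \<one>\<^bsub>R\<^esub>"
proof -
  have "k < k + p" using assms by auto
  note reorder_sign_pair[OF this]
  then have "struct_const (\<lambda>i. if i \<le> p then 1 else -1) {k, k + p} {k, k + p} = 1"
    using assms by (simp add: struct_const_def)
  then show ?thesis
    unfolding clifford_def blade_mult[OF pair_subset[OF assms] pair_subset[OF assms]]
    by (simp add: diag_clifford_simps blade_def)
qed

lemma u_pair_prod_commute:
  assumes "j \<le> p" "k \<in> {1..p}"
  shows "u k \<otimes>\<^bsub>R\<^esub> pair_prod R p j = pair_prod R p j \<otimes>\<^bsub>R\<^esub> u k"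
  using assms(1)
proof (induction j)
  case (Suc j)
  interpret ring R by (rule ring_clifford)
  let ?P = "pair_prod R p j" and ?v = "u (Suc j)"
  have c: "u k \<in> carrier R" "?v \<in> carrier R" "?P \<in> carrier R"
    using u_closed[OF assms(2)] u_closed[of "Suc j"] Suc.prems cl_pair_prod_closed by auto
  have "u k \<otimes>\<^bsub>R\<^esub> ?v = ?v \<otimes>\<^bsub>R\<^esub> u k"
    unfolding clifford_def by (rule pair_blades_commute) (use assms Suc.prems ps in auto)
  then have v: "u k \<otimes>\<^bsub>R\<^esub> (\<one>\<^bsub>R\<^esub> \<oplus>\<^bsub>R\<^esub> ?v) = (\<one>\<^bsub>R\<^esub> \<oplus>\<^bsub>R\<^esub> ?v) \<otimes>\<^bsub>R\<^esub> u k"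
    using c by (simp add: l_distr r_distr)
  have "u k \<otimes>\<^bsub>R\<^esub> pair_prod R p (Suc j) = (u k \<otimes>\<^bsub>R\<^esub> ?P) \<otimes>\<^bsub>R\<^esub> (\<one>\<^bsub>R\<^esub> \<oplus>\<^bsub>R\<^esub> ?v)"
    using c by (simp add: m_assoc)
  also have "\<dots> = ?P \<otimes>\<^bsub>R\<^esub> (u k \<otimes>\<^bsub>R\<^esub> (\<one>\<^bsub>R\<^esub> \<oplus>\<^bsub>R\<^esub> ?v))" using Suc c by (simp add: m_assoc)
  also have "\<dots> = pair_prod R p (Suc j) \<otimes>\<^bsub>R\<^esub> u k" unfolding v using c by (simp add: m_assoc)
  finally show ?case .
qed (use u_closed[OF assms(2)] in \<open>simp add: monoid.l_one monoid.r_one ring.is_monoid[OF ring_clifford]\<close>)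

text \<open>The factor \<open>1 + u k\<close> absorbs \<open>u k\<close> because \<open>u k\<close>
  squares to 1, and \<open>u k\<close> commutes past all later factors.\<close>

lemma pair_prod_u:
  assumes "j \<le> p" "k \<in> {1..j}"
  shows "pair_prod R p j \<otimes>\<^bsub>R\<^esub> u k = pair_prod R p j"
  using assms
proof (induction j)
  case (Suc j)
  interpret ring R by (rule ring_clifford)
  let ?P = "pair_prod R p j" and ?v = "u (Suc j)"
  have c: "u k \<in> carrier R" "?v \<in> carrier R" "?P \<in> carrier R"
    using u_closed[of k] u_closed[of "Suc j"] Suc.prems cl_pair_prod_closed by auto
  have comm: "u k \<otimes>\<^bsub>R\<^esub> ?v = ?v \<otimes>\<^bsub>R\<^esub> u k"
    unfolding clifford_def by (rule pair_blades_commute) (use Suc.prems ps in auto)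
  show ?case
  proof (cases "k = Suc j")
    case True
    have "(\<one>\<^bsub>R\<^esub> \<oplus>\<^bsub>R\<^esub> ?v) \<otimes>\<^bsub>R\<^esub> ?v = \<one>\<^bsub>R\<^esub> \<oplus>\<^bsub>R\<^esub> ?v"
      using c u_square[of "Suc j"] Suc.prems by (simp add: l_distr a_comm)
    then show ?thesis using c True by (simp add: m_assoc)
  next
    case False
    then have P: "?P \<otimes>\<^bsub>R\<^esub> u k = ?P" using Suc by auto
    have v: "(\<one>\<^bsub>R\<^esub> \<oplus>\<^bsub>R\<^esub> ?v) \<otimes>\<^bsub>R\<^esub> u k = u k \<otimes>\<^bsub>R\<^esub> (\<one>\<^bsub>R\<^esub> \<oplus>\<^bsub>R\<^esub> ?v)"
      using c comm by (simp add: l_distr r_distr)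
    have "pair_prod R p (Suc j) \<otimes>\<^bsub>R\<^esub> u k = ?P \<otimes>\<^bsub>R\<^esub> ((\<one>\<^bsub>R\<^esub> \<oplus>\<^bsub>R\<^esub> ?v) \<otimes>\<^bsub>R\<^esub> u k)"
      using c by (simp add: m_assoc)
    also have "\<dots> = (?P \<otimes>\<^bsub>R\<^esub> u k) \<otimes>\<^bsub>R\<^esub> (\<one>\<^bsub>R\<^esub> \<oplus>\<^bsub>R\<^esub> ?v)"
      unfolding v using c by (simp add: m_assoc)
    finally show ?thesis using P by simp
  qed
qed simp

text \<open>Each factor \<open>1 + u k\<close> acts on the full product as the scalar 2. For
  \<open>j = p\<close> this explains the normalization \<open>1 / 2 ^ p\<close>.\<close>

lemma pair_prod_mult_pair_prod:
  assumes "j \<le> p"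
  shows "pair_prod R p j \<otimes>\<^bsub>R\<^esub> pair_prod R p p = 2 ^ j \<odot>\<^bsub>R\<^esub> pair_prod R p p"
  using assms
proof (induction j)
  case 0
  interpret ring R by (rule ring_clifford)
  show ?case using cl_pair_prod_closed[of p] by simp (simp add: cl_simps)
next
  case (Suc j)
  interpret ring R by (rule ring_clifford)
  let ?P = "pair_prod R p j" and ?v = "u (Suc j)" and ?F = "pair_prod R p p"
  have c: "?v \<in> carrier R" "?P \<in> carrier R" "?F \<in> carrier R"
    using u_closed[of "Suc j"] Suc.prems cl_pair_prod_closed by auto
  have "?v \<otimes>\<^bsub>R\<^esub> ?F = ?F"
    using u_pair_prod_commute[of p "Suc j"] pair_prod_u[of p "Suc j"] Suc.prems by simp
  then have "(\<one>\<^bsub>R\<^esub> \<oplus>\<^bsub>R\<^esub> ?v) \<otimes>\<^bsub>R\<^esub> ?F = 2 \<odot>\<^bsub>R\<^esub> ?F"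
    using c by (simp add: l_distr) (simp add: cl_simps)
  then have "pair_prod R p (Suc j) \<otimes>\<^bsub>R\<^esub> ?F = ?P \<otimes>\<^bsub>R\<^esub> (2 \<odot>\<^bsub>R\<^esub> ?F)"
    using c by (simp add: m_assoc)
  also have "\<dots> = 2 \<odot>\<^bsub>R\<^esub> (2 ^ j \<odot>\<^bsub>R\<^esub> ?F)" using Suc by (simp add: cl_smult_mult)
  finally show ?case by (simp add: cl_simps mult.assoc)
qed

lemma f_U_closed: "f_U p s \<in> carrier R"
  unfolding f_U_eq[OF ps(1)] by (rule cl_smult_closed[OF cl_pair_prod_closed])

lemma f_U_idempotent: "f_U p s \<otimes>\<^bsub>R\<^esub> f_U p s = f_U p s"
proof -
  have "c * (c * (2 ^ p * r)) = c * r" if "c = 1 / 2 ^ p" for c r :: real using that by simp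
  then show ?thesis
    unfolding f_U_eq[OF ps(1)] cl_smult_mult pair_prod_mult_pair_prod[OF order_refl]
    by (simp add: cl_simps)
qed

lemma f_U_nonzero: "f_U p s \<noteq> \<zero>\<^bsub>R\<^esub>"
proof -
  have "pair_prod R p p {} = 1"
    unfolding clifford_def by (rule pair_prod_coeff_empty) (use ps in auto)
  then have "f_U p s {} \<noteq> 0" unfolding f_U_eq[OF ps(1)] by (simp add: cl_simps)
  then show ?thesis by (auto simp: cl_simps)
qed

lemma f_U_u:
  assumes "k \<in> {1..p}"
  shows "f_U p s \<otimes>\<^bsub>R\<^esub> u k = f_U p s" "u k \<otimes>\<^bsub>R\<^esub> f_U p s = f_U p s"
  unfolding f_U_eq[OF ps(1)] cl_smult_mult
  using assms by (simp_all add: u_pair_prod_commute pair_prod_u)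

text \<open>Such a blade overlaps no pair, so it commutes with every factor. These blades span the
  complement algebra \<open>D\<close>.\<close>

lemma pair_prod_blade_commute:
  assumes "A \<subseteq> {1..p + s}" "A \<inter> {1..2 * p} = {}" "j \<le> p"
  shows "pair_prod R p j \<otimes>\<^bsub>R\<^esub> blade A = blade A \<otimes>\<^bsub>R\<^esub> pair_prod R p j"
  using assms(3)
proof (induction j)
  case 0
  interpret ring R by (rule ring_clifford)
  show ?case using cl_blade_closed[OF assms(1)] by simp
next
  case (Suc j)
  interpret ring R by (rule ring_clifford)
  let ?P = "pair_prod R p j" and ?v = "u (Suc j)"
  have c: "?v \<in> carrier R" "?P \<in> carrier R" "blade A \<in> carrier R"
    using u_closed[of "Suc j"] Suc.prems cl_pair_prod_closed cl_blade_closed[OF assms(1)]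
    by auto
  have "A \<inter> {Suc j, Suc j + p} = {}" using assms(2) Suc.prems by auto
  then have "?v \<otimes>\<^bsub>R\<^esub> blade A = blade A \<otimes>\<^bsub>R\<^esub> ?v"
    using pair_blade_commute[of "Suc j" p "p + s" A "\<lambda>i. if i \<le> p then 1 else -1"] assms(1) Suc.prems ps
    unfolding clifford_def by (simp add: diag_clifford_simps)
  then have v: "(\<one>\<^bsub>R\<^esub> \<oplus>\<^bsub>R\<^esub> ?v) \<otimes>\<^bsub>R\<^esub> blade A = blade A \<otimes>\<^bsub>R\<^esub> (\<one>\<^bsub>R\<^esub> \<oplus>\<^bsub>R\<^esub> ?v)"
    using c by (simp add: l_distr r_distr)
  have "pair_prod R p (Suc j) \<otimes>\<^bsub>R\<^esub> blade A = ?P \<otimes>\<^bsub>R\<^esub> ((\<one>\<^bsub>R\<^esub> \<oplus>\<^bsub>R\<^esub> ?v) \<otimes>\<^bsub>R\<^esub> blade A)"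
    using c by (simp add: m_assoc)
  also have "\<dots> = (?P \<otimes>\<^bsub>R\<^esub> blade A) \<otimes>\<^bsub>R\<^esub> (\<one>\<^bsub>R\<^esub> \<oplus>\<^bsub>R\<^esub> ?v)"
    unfolding v using c by (simp add: m_assoc)
  also have "\<dots> = blade A \<otimes>\<^bsub>R\<^esub> pair_prod R p (Suc j)" using Suc c by (simp add: m_assoc)
  finally show ?case .
qed

text \<open>Since \<open>u k\<close> is absorbed by \<open>f\<close> on both sides, \<open>f e_A f\<close> vanishes when \<open>e_A\<close> anticommutes with
  some \<open>u k\<close>; otherwise all factors \<open>u k\<close> of \<open>e_A\<close> can be dropped.\<close>

lemma f_U_blade_f_U:
  assumes "A \<subseteq> {1..p + s}"
  shows "\<exists>x\<in>carrier R. (\<forall>B. x B \<noteq> 0 \<longrightarrow> B \<subseteq> {2 * p + 1..p + s}) \<and>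
    f_U p s \<otimes>\<^bsub>R\<^esub> blade A \<otimes>\<^bsub>R\<^esub> f_U p s = x \<otimes>\<^bsub>R\<^esub> f_U p s"
  using assms
proof (induction "card A" arbitrary: A rule: less_induct)
  case less
  interpret ring R by (rule ring_clifford)
  let ?f = "f_U p s"
  have bc: "blade A \<in> carrier R" by (rule cl_blade_closed[OF less.prems])
  have finA: "finite A" using less.prems finite_subset by blast
  show ?case
  proof (cases "A \<inter> {1..2 * p} = {}")
    case True
    then have "A \<subseteq> {2 * p + 1..p + s}" using less.prems by force
    moreover have "?f \<otimes>\<^bsub>R\<^esub> blade A = blade A \<otimes>\<^bsub>R\<^esub> ?f"
      unfolding f_U_eq[OF ps(1)] cl_smult_mult pair_prod_blade_commute[OF less.prems True order_refl] ..
    then have "?f \<otimes>\<^bsub>R\<^esub> blade A \<otimes>\<^bsub>R\<^esub> ?f = blade A \<otimes>\<^bsub>R\<^esub> ?f"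
      using bc f_U_closed f_U_idempotent by (simp add: m_assoc)
    ultimately show ?thesis using bc
      by (intro bexI[of _ "blade A"]) (auto simp: blade_def)
  next
    case False
    then obtain i where i: "i \<in> A" "1 \<le> i" "i \<le> 2 * p" by auto
    \<comment> \<open>The number of the pair containing \<open>i\<close>, whichever of its two
      members \<open>i\<close> is.\<close>
    define k where "k = (if i \<le> p then i else i - p)"
    have k: "k \<in> {1..p}" "k \<in> A \<or> k + p \<in> A" using i by (auto simp: k_def)
    show ?thesis
    proof (cases "k \<in> A \<and> k + p \<in> A")
      case True
      \<comment> \<open>Up to a nonzero constant \<open>e_A\<close> is \<open>e_A'\<close> times
        \<open>u k\<close>, and the right-hand \<open>f\<close> absorbs \<open>u k\<close>.\<close>
      define A' where "A' = A - {k, k + p}"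
      have A': "A' \<subseteq> {1..p + s}" "sym_diff A' {k, k + p} = A" "card A' < card A"
        using True less.prems psubset_card_mono[OF finA, of A'] by (auto simp: A'_def)
      then obtain x where x: "x \<in> carrier R" "\<forall>B. x B \<noteq> 0 \<longrightarrow> B \<subseteq> {2 * p + 1..p + s}"
        "?f \<otimes>\<^bsub>R\<^esub> blade A' \<otimes>\<^bsub>R\<^esub> ?f = x \<otimes>\<^bsub>R\<^esub> ?f"
        using less.hyps[OF A'(3,1)] by blast
      have b': "blade A' \<in> carrier R" by (rule cl_blade_closed[OF A'(1)])
      let ?c = "struct_const (\<lambda>i. if i \<le> p then 1 else -1) A' {k, k + p}"
      have c: "?c \<noteq> 0" by (rule struct_const_nonzero) simp
      have "blade A' \<otimes>\<^bsub>R\<^esub> u k = ?c \<odot>\<^bsub>R\<^esub> blade A"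
        unfolding clifford_def blade_mult[OF A'(1) pair_subset[OF k(1)]] A'(2) ..
      then have "blade A = (1 / ?c) \<odot>\<^bsub>R\<^esub> (blade A' \<otimes>\<^bsub>R\<^esub> u k)"
        using c by (simp add: cl_simps)
      then have "?f \<otimes>\<^bsub>R\<^esub> blade A \<otimes>\<^bsub>R\<^esub> ?f = (1 / ?c) \<odot>\<^bsub>R\<^esub> (?f \<otimes>\<^bsub>R\<^esub> (blade A' \<otimes>\<^bsub>R\<^esub> u k) \<otimes>\<^bsub>R\<^esub> ?f)"
        by (simp only: cl_smult_mult)
      also have "?f \<otimes>\<^bsub>R\<^esub> (blade A' \<otimes>\<^bsub>R\<^esub> u k) \<otimes>\<^bsub>R\<^esub> ?f = x \<otimes>\<^bsub>R\<^esub> ?f"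
        using b' u_closed[OF k(1)] f_U_closed f_U_u[OF k(1)] x(3) by (simp add: m_assoc)
      finally have "?f \<otimes>\<^bsub>R\<^esub> blade A \<otimes>\<^bsub>R\<^esub> ?f = ((1 / ?c) \<odot>\<^bsub>R\<^esub> x) \<otimes>\<^bsub>R\<^esub> ?f"
        by (simp only: cl_smult_mult)
      moreover have "((1 / ?c) \<odot>\<^bsub>R\<^esub> x) B \<noteq> 0 \<longrightarrow> B \<subseteq> {2 * p + 1..p + s}" for B
        using x(2) unfolding cl_simps by auto
      ultimately show ?thesis using cl_smult_closed[OF x(1)] by blast
    next
      \<comment> \<open>Writing \<open>f = f u_k\<close> and moving \<open>u_k\<close> past
        \<open>e_A\<close> into the right-hand \<open>f\<close> shows that \<open>f e_A f\<close>
        equals its own negative.\<close>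
      case False
      then have "A \<inter> {k, k + p} = {k} \<or> A \<inter> {k, k + p} = {k + p}" using k by auto
      then have "card (A \<inter> {k, k + p}) = 1" by auto
      then have anti: "u k \<otimes>\<^bsub>R\<^esub> blade A = (-1) \<odot>\<^bsub>R\<^esub> (blade A \<otimes>\<^bsub>R\<^esub> u k)"
        unfolding clifford_def using k(1) ps less.prems by (subst pair_blade_commute) auto
      have "?f \<otimes>\<^bsub>R\<^esub> blade A \<otimes>\<^bsub>R\<^esub> ?f = ?f \<otimes>\<^bsub>R\<^esub> u k \<otimes>\<^bsub>R\<^esub> blade A \<otimes>\<^bsub>R\<^esub> ?f"
        unfolding f_U_u[OF k(1)] ..
      also have "\<dots> = ?f \<otimes>\<^bsub>R\<^esub> (u k \<otimes>\<^bsub>R\<^esub> blade A) \<otimes>\<^bsub>R\<^esub> ?f"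
        using bc u_closed[OF k(1)] f_U_closed by (simp add: m_assoc)
      also have "\<dots> = (-1) \<odot>\<^bsub>R\<^esub> (?f \<otimes>\<^bsub>R\<^esub> (blade A \<otimes>\<^bsub>R\<^esub> u k) \<otimes>\<^bsub>R\<^esub> ?f)"
        unfolding anti cl_smult_mult ..
      also have "?f \<otimes>\<^bsub>R\<^esub> (blade A \<otimes>\<^bsub>R\<^esub> u k) \<otimes>\<^bsub>R\<^esub> ?f = ?f \<otimes>\<^bsub>R\<^esub> blade A \<otimes>\<^bsub>R\<^esub> ?f"
        using bc u_closed[OF k(1)] f_U_closed f_U_u[OF k(1)] by (simp add: m_assoc)
      finally have "?f \<otimes>\<^bsub>R\<^esub> blade A \<otimes>\<^bsub>R\<^esub> ?f = \<zero>\<^bsub>R\<^esub>" 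
        by (simp add: cl_simps fun_eq_iff)
      then show ?thesis using f_U_closed
        by (intro bexI[of _ "\<zero>\<^bsub>R\<^esub>"]) (auto simp: cl_zero_coeff)
    qed
  qed
qed

text \<open>The blade case extends by linearity: the witness for a linear combination is the same
  combination of witnesses.\<close>

lemma f_U_corner:
  assumes "y \<in> carrier R"
  shows "\<exists>x\<in>carrier R. (\<forall>B. x B \<noteq> 0 \<longrightarrow> B \<subseteq> {2 * p + 1..p + s}) \<and>
    f_U p s \<otimes>\<^bsub>R\<^esub> y \<otimes>\<^bsub>R\<^esub> f_U p s = x \<otimes>\<^bsub>R\<^esub> f_U p s"
  using assms
proof (induction rule: cl_blade_induct)
  case zero
  interpret ring R by (rule ring_clifford)
  have "f_U p s \<otimes>\<^bsub>R\<^esub> \<zero>\<^bsub>R\<^esub> \<otimes>\<^bsub>R\<^esub> f_U p s = \<zero>\<^bsub>R\<^esub> \<otimes>\<^bsub>R\<^esub> f_U p s" using f_U_closed by simp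
  then show ?case using zero_closed cl_zero_coeff by metis
next
  case (add y A c)
  interpret ring R by (rule ring_clifford)
  let ?f = "f_U p s"
  obtain x where x: "x \<in> carrier R" "\<forall>B. x B \<noteq> 0 \<longrightarrow> B \<subseteq> {2 * p + 1..p + s}"
    "?f \<otimes>\<^bsub>R\<^esub> y \<otimes>\<^bsub>R\<^esub> ?f = x \<otimes>\<^bsub>R\<^esub> ?f" using add by blast
  obtain z where z: "z \<in> carrier R" "\<forall>B. z B \<noteq> 0 \<longrightarrow> B \<subseteq> {2 * p + 1..p + s}"
    "?f \<otimes>\<^bsub>R\<^esub> blade A \<otimes>\<^bsub>R\<^esub> ?f = z \<otimes>\<^bsub>R\<^esub> ?f" using f_U_blade_f_U[OF add(2)] by blast
  have b: "blade A \<in> carrier R" by (rule cl_blade_closed[OF add(2)])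
  have "?f \<otimes>\<^bsub>R\<^esub> (y \<oplus>\<^bsub>R\<^esub> c \<odot>\<^bsub>R\<^esub> blade A) \<otimes>\<^bsub>R\<^esub> ?f = (x \<oplus>\<^bsub>R\<^esub> c \<odot>\<^bsub>R\<^esub> z) \<otimes>\<^bsub>R\<^esub> ?f"
    using add(1) f_U_closed x z b by (simp add: l_distr r_distr cl_smult_closed cl_smult_mult)
  moreover have "B \<subseteq> {2 * p + 1..p + s}" if "(x \<oplus>\<^bsub>R\<^esub> c \<odot>\<^bsub>R\<^esub> z) B \<noteq> 0" for B
    using that x(2) z(2) by (cases "x B = 0") (auto simp: cl_simps)
  ultimately show ?case using x z by (intro bexI[of _ "x \<oplus>\<^bsub>R\<^esub> c \<odot>\<^bsub>R\<^esub> z"]) (auto simp: cl_smult_closed)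
qed

text \<open>A corner element is \<open>x f\<close> with \<open>x\<close> in \<open>D\<close>. The
  conjugate of \<open>x\<close> times \<open>x\<close> is the scalar \<open>N\<close>, a sum of
  squares that is positive for nonzero \<open>x\<close>; dividing the conjugate by \<open>N\<close>
  gives \<open>z\<close> with \<open>z x = 1\<close>, hence \<open>z (x f) = f\<close>.\<close>

lemma f_U_corner_division:
  assumes "y \<in> carrier R" "f_U p s \<otimes>\<^bsub>R\<^esub> y \<otimes>\<^bsub>R\<^esub> f_U p s \<noteq> \<zero>\<^bsub>R\<^esub>"
  shows "\<exists>z\<in>carrier R. z \<otimes>\<^bsub>R\<^esub> (f_U p s \<otimes>\<^bsub>R\<^esub> y \<otimes>\<^bsub>R\<^esub> f_U p s) = f_U p s"
proof -
  interpret ring R by (rule ring_clifford)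
  let ?f = "f_U p s" and ?Q = "\<lambda>i. if i \<le> p then 1 else (-1::real)"
  obtain x where x: "x \<in> carrier R" "\<And>B. x B \<noteq> 0 \<Longrightarrow> B \<subseteq> {2 * p + 1..p + s}"
    "?f \<otimes>\<^bsub>R\<^esub> y \<otimes>\<^bsub>R\<^esub> ?f = x \<otimes>\<^bsub>R\<^esub> ?f" using f_U_corner[OF assms(1)] by blast
  \<comment> \<open>The bound \<open>s \<le> p + 2\<close> enters here. For smaller \<open>s\<close>
    the two-element set exceeds the available generators, but only containment of the support
    matters.\<close>
  have "{2 * p + 1..p + s} \<subseteq> {2 * p + 1, 2 * p + 2}" using ps by auto
  then have supp: "B \<subseteq> {2 * p + 1, 2 * p + 2}" if "x B \<noteq> 0" for B using x(2)[OF that] by blast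
  define xc where "xc = (\<lambda>A. struct_const ?Q A A * x A)"
  define N where "N = (\<Sum>A\<in>Pow {1..p + s}. (struct_const ?Q A A * x A)\<^sup>2)"
  have xc: "xc \<in> carrier R" using x(1) by (simp add: xc_def cl_simps)
  have mult: "xc \<otimes>\<^bsub>R\<^esub> x = N \<odot>\<^bsub>R\<^esub> \<one>\<^bsub>R\<^esub>"
    unfolding xc_def N_def clifford_def
    by (rule diag_clifford_conj_mult[of _ "2 * p + 1" "2 * p + 2"]) (use supp in auto)
  have "x \<noteq> \<zero>\<^bsub>R\<^esub>" using assms(2) x f_U_closed by auto
  then obtain B where B: "x B \<noteq> 0" by (auto simp: cl_simps)
  then have "B \<in> Pow {1..p + s}" using x(1) by (auto simp: cl_simps)
  moreover have "struct_const ?Q B B * x B \<noteq> 0" using B struct_const_nonzero[of ?Q] by simp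
  ultimately have "N > 0" unfolding N_def by (intro sum_pos2[of _ B]) auto
  then have "((1 / N) \<odot>\<^bsub>R\<^esub> xc) \<otimes>\<^bsub>R\<^esub> x = \<one>\<^bsub>R\<^esub>"
    unfolding cl_smult_mult mult by (simp add: cl_simps)
  then have "((1 / N) \<odot>\<^bsub>R\<^esub> xc) \<otimes>\<^bsub>R\<^esub> (x \<otimes>\<^bsub>R\<^esub> ?f) = ?f"
    using x(1) xc f_U_closed by (simp add: m_assoc[symmetric] cl_smult_closed)
  then show ?thesis unfolding x(3) using cl_smult_closed[OF xc] by blast
qed

lemma f_U_idempotent_elem: "idempotent_elem R (f_U p s)"
  by (simp add: idempotent_elem_def f_U_closed f_U_idempotent)

lemma f_U_primitive: "primitive_idempotent R (f_U p s)"
  by (rule ring.primitive_idempotent_if_corner_division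
      [OF ring_clifford f_U_idempotent_elem f_U_nonzero f_U_corner_division])

lemma f_U_minimal: "minimal_left_ideal (principal_left_ideal R (f_U p s)) R"
proof (rule ring.minimal_left_ideal_if_corner_division
      [OF ring_clifford f_U_idempotent_elem f_U_nonzero f_U_corner_division])
  fix x assume "x \<in> carrier R" "x \<otimes>\<^bsub>R\<^esub> f_U p s = x" "x \<noteq> \<zero>\<^bsub>R\<^esub>"
  then show "\<exists>a\<in>carrier R. f_U p s \<otimes>\<^bsub>R\<^esub> a \<otimes>\<^bsub>R\<^esub> x \<noteq> \<zero>\<^bsub>R\<^esub>"
    using f_U_closed diag_clifford_nondegenerate[where n = "p + s" and x = x and f = "f_U p s"
      and Q = "\<lambda>i. if i \<le> p then 1 else -1"]
    unfolding clifford_def by simp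
qed

end

theorem theorem3p4:
  fixes p :: nat
  assumes "p \<ge> 1"
  shows "unitary_structure p (J0 p) (omega0 p) (g0 p) \<and>
    induces_minimal_left_ideal (2 * p) {omega0 p} p p (f_U p p) \<and>
    induces_embedded_minimal_left_ideal (2 * p) {omega0 p} p (p + 1) (f_U p (p + 1)) \<and>
    induces_embedded_minimal_left_ideal (2 * p) {omega0 p} p (p + 2) (f_U p (p + 2)) \<and>
    (\<forall>s\<in>{p, p + 1, p + 2}.
       primitive_idempotent (clifford p s) (f_U p s) \<and>
       minimal_left_ideal (principal_left_ideal (clifford p s) (f_U p s)) (clifford p s))"
proof -
  have "\<exists>\<psi>\<in>algebraic_expressions (2 * p) {omega0 p}. f_U p s = quantization (2 * p) p s \<psi>" for s
    unfolding f_U_def using kahler_poly_algebraic[OF omega0_closed] by blast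
  then show ?thesis
    unfolding induces_minimal_left_ideal_def induces_embedded_minimal_left_ideal_def
    using unitary_structure_standard omega0_closed f_U_primitive f_U_minimal by auto
qed

end
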